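(* Let $X_1,X_2,\ldots$ be i.i.d. random vectors with distribution $N_p(0,\mathbf I_p)$. Then for every $t\in\mathbb R^p$, as $n\to\infty$, $$\sqrt n\,\bigl(H_{\Lambda^{(n)}}(t)-\mathbf I_p\bigr)=\frac1{\sqrt n}\sum_{i=1}^n h(X_i;t)+o_p(1),$$ where $h(x;t):=e^{-\|t\|^2}\bigl(g_1(x;t)+g_2(x;t)\bigr)$, with $H_{\Lambda^{(n)}}$, $g_1$, $g_2$ as defined in the context.
   Context: Fix $p\ge1$. $\mathbf I_p$ is the $p\times p$ identity matrix, $\|\cdot\|$ the Euclidean norm, $\mathbb 1(\cdot)$ the indicator function. For a sample $X_1,\ldots,X_n$ ($n\ge p+1$) in $\mathbb R^p$ let $\overline X_n=n^{-1}\sum_{i=1}^n X_i$, $S_n=n^{-1}\sum_{i=1}^n(X_i-\overline X_n)(X_i-\overline X_n)^\top$ (invertible almost surely for normal data), $S_n^{-1/2}$ the unique symmetric positive definite square root of $S_n^{-1}$, and let the scaled residuals be $Z_{n,i}=S_n^{-1/2}(X_i-\overline X_n)$. Define $$M^{(n)}(t)=\frac1n\sum_{i=1}^n e^{t^\top Z_{n,i}},\quad \nabla M^{(n)}(t)=\frac1n\sum_{i=1}^n Z_{n,i}e^{t^\top Z_{n,i}},\quad H_{M^{(n)}}(t)=\frac1n\sum_{i=1}^n Z_{n,i}Z_{n,i}^\top e^{t^\top Z_{n,i}},$$ $$H_{\Lambda^{(n)}}(t)=\frac{M^{(n)}(t)H_{M^{(n)}}(t)-\nabla M^{(n)}(t)(\nabla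 M^{(n)}(t))^\top}{M^{(n)}(t)^2}$$ (the Hessian of $\Lambda^{(n)}=\log M^{(n)}$). For $x,t\in\mathbb R^p$ define $$f_0(x;t)=e^{\|t\|^2/2}\Bigl\{-t^\top x-\tfrac12(t^\top x)^2+\tfrac12\|t\|^2\Bigr\}\in\mathbb R,$$ $$f_1(x;t)=e^{\|t\|^2/2}\Bigl\{-(\mathbf I_p+tt^\top)x-\tfrac12(2\mathbf I_p+tt^\top)(xx^\top-\mathbf I_p)t\Bigr\}\in\mathbb R^p,$$ $$f_2(x;t)=e^{\|t\|^2/2}\Bigl\{-\tfrac12(xx^\top-\mathbf I_p)(\mathbf I_p+tt^\top)-xt^\top-\tfrac12(\mathbf I_p+tt^\top)(xx^\top-\mathbf I_p)-tx^\top-\tfrac12\sum_{h=1}^p\sum_{k=1}^p\Bigl(\frac{\partial tt^\top}{\partial t_h}+tt^\top t_h+t_h\mathbf I_p\Bigr)t_k\bigl(x_hx_k-\mathbb 1(h=k)\bigr)-(\mathbf I_p+tt^\top)\,t^\top x\Bigr\}\in\mathbb R^{p\times p},$$ where $\partial tt^\top/\partial t_h$ is the entrywise derivative of the matrix $tt^\top$ and in the last term the scalar $t^\top x$ multiplies the matrix. Finally $$g_1(x;t)=e^{\|t\|^2/2}e^{t^\top x}\bigl(xx^\top+tt^\top-tx^\top-xt^\top-\mathbf I_p\bigr),$$ $$g_2(x;t)=e^{\|t\|^2/2}\bigl\{f_2(x;t)+(tt^\top+\mathbf I_p)f_0(x;t)-t f_1(x;t)^\top-f_1(x;t)t^\top-2f_0(x;t)\mathbf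 I_p\bigr\}.$$ $o_p(1)$ for matrices is understood entrywise. *)

theory Defs
  imports "HOL-Probability.Probability"
begin

definition outer :: "real^'p \<Rightarrow> real^'p \<Rightarrow> real^'p^'p" where
  "outer x y = (\<chi> i j. x $ i * y $ j)"

text \<open>Lebesgue density of the distribution \<open>N\<^sub>p(0, I\<^sub>p)\<close>.\<close>

definition std_mvn_density :: "real^'p \<Rightarrow> real" where
  "std_mvn_density x = exp (- (norm x)\<^sup>2 / 2) / sqrt (2 * pi) ^ CARD('p)"

text \<open>
  Measurability is part of the notion, because \<^const>\<open>measure\<close> is 0 on
  sets that are not measurable.
\<close>

definition small_op_1 :: "'a measure \<Rightarrow> (nat \<Rightarrow> 'a \<Rightarrow> real) \<Rightarrow> bool" where
  "small_op_1 M R \<longleftrightarrow>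
     (\<forall>n. R n \<in> borel_measurable M) \<and>
     (\<forall>\<epsilon>>0. (\<lambda>n. measure M {\<omega> \<in> space M. \<bar>R n \<omega>\<bar> > \<epsilon>}) \<longlonglongrightarrow> 0)"

definition sym_pos_def :: "real^'p^'p \<Rightarrow> bool" where
  "sym_pos_def A \<longleftrightarrow> transpose A = A \<and> (\<forall>v. v \<noteq> 0 \<longrightarrow> v \<bullet> (A *v v) > 0)"

text \<open>
  Only meaningful for an invertible matrix with a symmetric positive definite inverse;
  otherwise it is some unspecified matrix.
\<close>

definition inv_sqrt :: "real^'p^'p \<Rightarrow> real^'p^'p" where
  "inv_sqrt S = (THE B. sym_pos_def B \<and> B ** B = matrix_inv S)"

text \<open>
  A sample is a sequence \<open>x\<close>, of which only the first \<open>n\<close> terms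
  \<open>x 0, \<dots>, x (n - 1)\<close> are used.
\<close>

definition sample_mean :: "nat \<Rightarrow> (nat \<Rightarrow> real^'p) \<Rightarrow> real^'p" where
  "sample_mean n x = (1 / real n) *\<^sub>R (\<Sum>i<n. x i)"

definition sample_cov :: "nat \<Rightarrow> (nat \<Rightarrow> real^'p) \<Rightarrow> real^'p^'p" where
  "sample_cov n x =
     (1 / real n) *\<^sub>R (\<Sum>i<n. outer (x i - sample_mean n x) (x i - sample_mean n x))"

definition scaled_residual :: "nat \<Rightarrow> (nat \<Rightarrow> real^'p) \<Rightarrow> nat \<Rightarrow> real^'p" where
  "scaled_residual n x i = inv_sqrt (sample_cov n x) *v (x i - sample_mean n x)"

definition emp_mgf :: "nat \<Rightarrow> (nat \<Rightarrow> real^'p) \<Rightarrow> real^'p \<Rightarrow> real" where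
  "emp_mgf n x t = (1 / real n) * (\<Sum>i<n. exp (t \<bullet> scaled_residual n x i))"

definition grad_emp_mgf :: "nat \<Rightarrow> (nat \<Rightarrow> real^'p) \<Rightarrow> real^'p \<Rightarrow> real^'p" where
  "grad_emp_mgf n x t =
     (1 / real n) *\<^sub>R (\<Sum>i<n. exp (t \<bullet> scaled_residual n x i) *\<^sub>R scaled_residual n x i)"

definition hess_emp_mgf :: "nat \<Rightarrow> (nat \<Rightarrow> real^'p) \<Rightarrow> real^'p \<Rightarrow> real^'p^'p" where
  "hess_emp_mgf n x t =
     (1 / real n) *\<^sub>R (\<Sum>i<n. exp (t \<bullet> scaled_residual n x i) *\<^sub>R
        outer (scaled_residual n x i) (scaled_residual n x i))"

definition hess_emp_cgf :: "nat \<Rightarrow> (nat \<Rightarrow> real^'p) \<Rightarrow> real^'p \<Rightarrow> real^'p^'p" where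
  "hess_emp_cgf n x t =
     (1 / (emp_mgf n x t)\<^sup>2) *\<^sub>R
       (emp_mgf n x t *\<^sub>R hess_emp_mgf n x t - outer (grad_emp_mgf n x t) (grad_emp_mgf n x t))"

definition matrix_partial :: "'p \<Rightarrow> (real^'p \<Rightarrow> real^'p^'p) \<Rightarrow> real^'p \<Rightarrow> real^'p^'p" where
  "matrix_partial h F t = (\<chi> i j. deriv (\<lambda>s. F (t + s *\<^sub>R axis h 1) $ i $ j) 0)"

definition f0 :: "real^'p \<Rightarrow> real^'p \<Rightarrow> real" where
  "f0 x t = exp ((norm t)\<^sup>2 / 2) * (- (t \<bullet> x) - 1/2 * (t \<bullet> x)\<^sup>2 + 1/2 * (norm t)\<^sup>2)"

definition f1 :: "real^'p \<Rightarrow> real^'p \<Rightarrow> real^'p" where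
  "f1 x t = exp ((norm t)\<^sup>2 / 2) *\<^sub>R
     (- ((mat 1 + outer t t) *v x)
      - (1/2) *\<^sub>R ((2 *\<^sub>R mat 1 + outer t t) *v ((outer x x - mat 1) *v t)))"

definition f2 :: "real^'p \<Rightarrow> real^'p \<Rightarrow> real^'p^'p" where
  "f2 x t = exp ((norm t)\<^sup>2 / 2) *\<^sub>R
     (- ((1/2) *\<^sub>R ((outer x x - mat 1) ** (mat 1 + outer t t)))
      - outer x t
      - (1/2) *\<^sub>R ((mat 1 + outer t t) ** (outer x x - mat 1))
      - outer t x
      - (1/2) *\<^sub>R (\<Sum>h\<in>UNIV. \<Sum>k\<in>UNIV.
           (t $ k * (x $ h * x $ k - (if h = k then 1 else 0))) *\<^sub>R
           (matrix_partial h (\<lambda>u. outer u u) t + (t $ h) *\<^sub>R outer t t + (t $ h) *\<^sub>R mat 1))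
      - (t \<bullet> x) *\<^sub>R (mat 1 + outer t t))"

definition g1 :: "real^'p \<Rightarrow> real^'p \<Rightarrow> real^'p^'p" where
  "g1 x t = (exp ((norm t)\<^sup>2 / 2) * exp (t \<bullet> x)) *\<^sub>R
     (outer x x + outer t t - outer t x - outer x t - mat 1)"

definition g2 :: "real^'p \<Rightarrow> real^'p \<Rightarrow> real^'p^'p" where
  "g2 x t = exp ((norm t)\<^sup>2 / 2) *\<^sub>R
     (f2 x t + f0 x t *\<^sub>R (outer t t + mat 1)
      - outer t (f1 x t) - outer (f1 x t) t - (2 * f0 x t) *\<^sub>R mat 1)"

definition h :: "real^'p \<Rightarrow> real^'p \<Rightarrow> real^'p^'p" where
  "h x t = exp (- (norm t)\<^sup>2) *\<^sub>R (g1 x t + g2 x t)"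

end

theory Submission
  imports Defs "HOL-Library.Landau_Symbols"
begin

text \<open>
  Write \<open>Z\<^sub>i = X\<^sub>i + (D X\<^sub>i + c)\<close> with \<open>D = S\<^sup>-\<^sup>1\<^sup>/\<^sup>2 - I\<close> and \<open>c = - S\<^sup>-\<^sup>1\<^sup>/\<^sup>2 m\<close>, where \<open>m\<close> is the sample
  mean. Outside an event of small probability, finitely many sample averages lie within \<open>K / \<surd>n\<close> of
  their expectations (Chebyshev). On such samples everything is deterministic and uniform: \<open>D\<close> is
  \<open>- 1/2\<close> times the centred second moment matrix and \<open>c\<close> is minus the mean, both up to \<open>O(1/n)\<close>; a
  second order Taylor estimate under an integrable envelope \<open>exp (a |x|)\<close> then expands \<open>M\<close>, its gradient
  and its Hessian, with linear terms \<open>f\<^sub>0, f\<^sub>1, f\<^sub>2\<close> that come from the moments of the tilted normal law.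
  Since \<open>M H - \<nabla>M \<nabla>M\<^sup>T - M\<^sup>2 I\<close> vanishes at the limit, linearising it and dividing by \<open>M\<^sup>2\<close> gives \<open>h\<close>.
\<close>

subsection \<open>Square roots of matrices near the identity\<close>

text \<open>Write m for exp(|t|^2/2), the normal moment generating function at t. M, its gradient
  and its Hessian tend to m, m t and m (I + t t^T), so the limit of the linearised expression is m^2
  (I + t t^T - t t^T - I) = 0, and the factor exp(-|t|^2) in \<open>h\<close> is 1 / m^2. In the
  linear part, \<open>g1\<close> collects the fluctuations of averages over the raw observations and
  \<open>g2\<close> the effect of estimating mean and covariance. All residuals share D and c, so
  their first order terms do not form a sum of independent variables. They do once the averages
  multiplying D and c are replaced by their expectations: the error is a product of two quantities
  of order 1/sqrt n, which still vanishes after scaling by sqrt n. Two obstacles shape the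
  development. Convergence in probability has to become deterministic convergence: K is fixed,
  limits are taken along a filter on pairs of a size and a sample, and only then is K chosen large.
  And \<open>small_op_1\<close> demands measurability on the whole space, including samples with
  singular covariance, although \<open>inv_sqrt\<close> is a definite description.\<close>

text \<open>The norm of this matrix type is the Frobenius norm, so submultiplicativity is
  Cauchy-Schwarz applied to each entry.\<close>

lemma norm_matrix_mult_le:
  fixes A :: "real^'n^'m" and B :: "real^'k^'n"
  shows "norm (A ** B) \<le> norm A * norm B"
proof -
  have e: "(norm C)\<^sup>2 = (\<Sum>i\<in>UNIV. \<Sum>j\<in>UNIV. (C $ i $ j)\<^sup>2)" for C :: "real^'b^'c"
    by (simp add: norm_vec_def L2_set_def sum_nonneg real_sqrt_pow2)
  have "(norm (A ** B))\<^sup>2 = (\<Sum>i\<in>UNIV. \<Sum>j\<in>UNIV. (\<Sum>k\<in>UNIV. A $ i $ k * B $ k $ j)\<^sup>2)"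
    unfolding e by (simp add: matrix_matrix_mult_def)
  also have "\<dots> \<le> (\<Sum>i\<in>UNIV. \<Sum>j\<in>UNIV. (\<Sum>k\<in>UNIV. (A $ i $ k)\<^sup>2) * (\<Sum>k\<in>UNIV. (B $ k $ j)\<^sup>2))"
    by (intro sum_mono Cauchy_Schwarz_ineq_sum)
  also have "\<dots> = (norm A)\<^sup>2 * (\<Sum>j\<in>UNIV. \<Sum>k\<in>UNIV. (B $ k $ j)\<^sup>2)"
    unfolding e by (simp add: sum_product)
  also have "(\<Sum>j\<in>UNIV. \<Sum>k\<in>UNIV. (B $ k $ j)\<^sup>2) = (norm B)\<^sup>2"
    unfolding e by (rule sum.swap)
  finally show ?thesis
    by (metis norm_ge_zero power2_le_imp_le power_mult_distrib split_mult_pos_le)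
qed

lemma norm_matrix_vector_mult_le:
  fixes A :: "real^'n^'m"
  shows "norm (A *v x) \<le> norm A * norm x"
proof -
  have "\<bar>(A *v x) $ i\<bar> \<le> norm (A $ i) * norm x" for i
    using Cauchy_Schwarz_ineq2[of "A $ i" x]
    by (simp add: matrix_vector_mult_def inner_vec_def)
  then have "norm (A *v x) \<le> L2_set (\<lambda>i. norm (A $ i) * norm x) UNIV"
    unfolding norm_vec_def[of "A *v x"] by (intro L2_set_mono) auto
  also have "\<dots> = norm A * norm x"
    by (simp add: norm_vec_def[of A] L2_set_left_distrib)
  finally show ?thesis .
qed

lemma matrix_entry_le_norm: "\<bar>A $ i $ j\<bar> \<le> norm (A :: real^'n^'m)"
  by (meson Finite_Cartesian_Product.norm_nth_le component_le_norm_cart order_trans)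

lemma norm_matrix_le_sum: "norm (A :: real^'n^'m) \<le> (\<Sum>i\<in>UNIV. \<Sum>j\<in>UNIV. \<bar>A $ i $ j\<bar>)"
proof -
  have "norm A \<le> (\<Sum>i\<in>UNIV. norm (A $ i))"
    by (simp add: norm_vec_def L2_set_le_sum)
  also have "\<dots> \<le> (\<Sum>i\<in>UNIV. \<Sum>j\<in>UNIV. \<bar>A $ i $ j\<bar>)"
    by (intro sum_mono) (rule norm_le_l1_cart)
  finally show ?thesis .
qed

lemma matrix_add_rdistrib: "(A + B) ** (C::real^'k^'n) = A ** C + B ** (C::real^'k^'n)"
  by (simp add: matrix_matrix_mult_def vec_eq_iff sum.distrib algebra_simps)

lemma transpose_add: "transpose (A + B) = transpose A + transpose (B::real^'n^'m)"
  by (simp add: transpose_def vec_eq_iff)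

lemma transpose_diff: "transpose (A - B) = transpose A - transpose (B::real^'n^'m)"
  by (simp add: transpose_def vec_eq_iff)

lemma transpose_scaleR: "transpose (c *\<^sub>R A) = c *\<^sub>R transpose (A::real^'n^'m)"
  by (simp add: transpose_def vec_eq_iff)

lemma matrix_diff_ldistrib: "(A::real^'n^'m) ** (B - C) = A ** B - A ** C"
  by (simp add: matrix_matrix_mult_def vec_eq_iff sum_subtractf algebra_simps)

lemma matrix_diff_rdistrib: "(A - B) ** (C::real^'k^'n) = A ** C - B ** (C::real^'k^'n)"
  by (simp add: matrix_matrix_mult_def vec_eq_iff sum_subtractf algebra_simps)

text \<open>With \<open>D = B - C\<close> and \<open>P = B + C\<close> one has \<open>P D + D P = 0\<close>, hence \<open>tr (D P D) = 0\<close>.\<close>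

lemma sym_pos_def_square_inject:
  fixes B C :: "real^'n^'n"
  assumes B: "sym_pos_def B" and C: "sym_pos_def C" and eq: "B ** B = C ** C"
  shows "B = C"
proof -
  define D where "D = B - C"
  define P where "P = B + C"
  have symD: "transpose D = D"
    using B C by (simp add: D_def sym_pos_def_def transpose_diff)
  have pos: "v \<bullet> (P *v v) > 0" if "v \<noteq> 0" for v
    using B C that by (simp add: P_def sym_pos_def_def matrix_vector_mult_add_rdistrib inner_add_right add_pos_pos)
  have PD: "P ** D + D ** P = 0"
    by (simp add: P_def D_def matrix_diff_ldistrib matrix_diff_rdistrib matrix_add_ldistrib
        matrix_add_rdistrib eq)
  have tr: "trace (X ** Y) = trace (Y ** X)" for X Y :: "real^'n^'n"
    by (rule trace_mul_sym)
  have "trace (D ** (P ** D)) + trace (D ** (D ** P)) = 0"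
    using arg_cong[OF PD, of "\<lambda>X. trace (D ** X)"]
    by (simp add: matrix_add_ldistrib trace_add) (simp add: trace_def)
  moreover have "trace (D ** (D ** P)) = trace (D ** (P ** D))"
    by (metis matrix_mul_assoc tr)
  ultimately have "trace (D ** (P ** D)) = 0" by simp
  \<comment> \<open>Since D is symmetric, each diagonal entry of D P D is the quadratic form of P at
    a column of D. A zero trace then forces every column to vanish.\<close>
  moreover have "trace (D ** (P ** D)) = (\<Sum>i\<in>UNIV. column i D \<bullet> (P *v column i D))"
  proof -
    have "(D ** (P ** D)) $ i $ i = column i D \<bullet> (P *v column i D)" for i
    proof -
      have "D $ i $ k = D $ k $ i" for k
        using symD by (metis transpose_def vec_lambda_beta)
      then show ?thesis
        by (simp add: matrix_matrix_mult_def matrix_vector_mult_def column_def inner_vec_def)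
    qed
    then show ?thesis by (simp add: trace_def)
  qed
  ultimately have "(\<Sum>i\<in>UNIV. column i D \<bullet> (P *v column i D)) = 0" by simp
  moreover have nn: "v \<bullet> (P *v v) \<ge> 0" for v
    using pos[of v] by (cases "v = 0") auto
  ultimately have "column i D \<bullet> (P *v column i D) = 0" for i
    by (metis (no_types, lifting) UNIV_I finite sum_nonneg_eq_0_iff)
  then have "column i D = 0" for i
    using pos by (metis less_irrefl)
  then have "D = 0"
    by (simp add: vec_eq_iff column_def)
  then show ?thesis by (simp add: D_def)
qed

lemma inv_sqrt_eqI:
  assumes "sym_pos_def B" "B ** B = matrix_inv S"
  shows "inv_sqrt S = B"
  unfolding inv_sqrt_def
  using assms by (intro the_equality) (auto intro: sym_pos_def_square_inject)

text \<open>The fixed point \<open>Y\<close> of \<open>Y \<mapsto> (X + Y\<^sup>2) / 2\<close> satisfies \<open>(1 - Y)\<^sup>2 = 1 - X\<close>.\<close>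

lemma matrix_sqrt_near_one:
  fixes X :: "real^'n^'n"
  assumes sym: "transpose X = X" and X: "norm X \<le> 1/4"
  obtains Y where "sym_pos_def (mat 1 - Y)" "(mat 1 - Y) ** (mat 1 - Y) = mat 1 - X"
    "norm Y \<le> norm X" "Y = (1/2) *\<^sub>R X + (1/2) *\<^sub>R (Y ** Y)"
proof -
  define f where "f Y = (1/2) *\<^sub>R X + (1/2) *\<^sub>R (Y ** Y)" for Y
  \<comment> \<open>On the ball of radius 1/4 the map \<open>f\<close> has values of norm at most
    1/8 + 1/32 and is a contraction. Symmetry belongs to \<open>s\<close> so that the fixed point
    inherits it.\<close>
  define s where "s = {Y::real^'n^'n. transpose Y = Y \<and> norm Y \<le> 1/4}"
  have "closed {Y::real^'n^'n. transpose Y = Y}"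
  proof -
    have "continuous_on UNIV (transpose :: real^'n^'n \<Rightarrow> _)"
      unfolding transpose_def by (intro continuous_intros)
    then show ?thesis by (intro closed_Collect_eq continuous_intros)
  qed
  moreover have "closed {Y::real^'n^'n. norm Y \<le> 1/4}"
    by (intro closed_Collect_le continuous_intros)
  ultimately have "closed s" unfolding s_def by (simp add: Collect_conj_eq closed_Int)
  note cs = this[unfolded complete_eq_closed[symmetric]]
  have "0 \<in> s" by (simp add: s_def transpose_def vec_eq_iff)
  then have ne: "s \<noteq> {}" by auto
  have im: "f ` s \<subseteq> s"
  proof
    fix Z assume "Z \<in> f ` s"
    then obtain Y where Y: "Y \<in> s" and Z: "Z = f Y" by auto
    have "norm (Y ** Y) \<le> norm Y * norm Y" by (rule norm_matrix_mult_le)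
    also have "\<dots> \<le> 1/4 * (1/4)" using Y by (intro mult_mono) (auto simp: s_def)
    finally have "norm Z \<le> 1/4"
      unfolding Z f_def using X norm_triangle_ineq[of "(1/2) *\<^sub>R X" "(1/2) *\<^sub>R (Y ** Y)"] by simp
    then show "Z \<in> s"
      using Y sym by (simp add: s_def Z f_def transpose_add transpose_scaleR matrix_transpose_mul)
  qed
  have lip: "dist (f Y) (f Z) \<le> 1/2 * dist Y Z" if "Y \<in> s" "Z \<in> s" for Y Z
  proof -
    have *: "f Y - f Z = (1/2) *\<^sub>R (Y ** (Y - Z)) + (1/2) *\<^sub>R ((Y - Z) ** Z)"
      by (simp add: f_def matrix_diff_ldistrib matrix_diff_rdistrib algebra_simps)
    have 1: "norm (Y ** (Y - Z)) \<le> 1/4 * norm (Y - Z)"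
      by (rule order_trans[OF norm_matrix_mult_le mult_right_mono]) (use that in \<open>auto simp: s_def\<close>)
    have 2: "norm ((Y - Z) ** Z) \<le> norm (Y - Z) * (1/4)"
      by (rule order_trans[OF norm_matrix_mult_le mult_left_mono]) (use that in \<open>auto simp: s_def\<close>)
    have "norm (f Y - f Z) \<le> 1/2 * norm (Y ** (Y - Z)) + 1/2 * norm ((Y - Z) ** Z)"
      unfolding * by (rule norm_triangle_le) simp
    then show ?thesis
      unfolding dist_norm using 1 2 norm_ge_zero[of "Y - Z"] by linarith
  qed
  obtain Y where Ys: "Y \<in> s" and fY: "f Y = Y"
    using Banach_fix[OF cs ne _ _ im lip] by auto
  have eq: "Y = (1/2) *\<^sub>R X + (1/2) *\<^sub>R (Y ** Y)" using fY by (simp add: f_def)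
  have nY: "norm Y \<le> 1/4" and tY: "transpose Y = Y" using Ys by (auto simp: s_def)
  have "norm Y \<le> 1/2 * norm X + 1/2 * norm (Y ** Y)"
    using norm_triangle_ineq[of "(1/2) *\<^sub>R X" "(1/2) *\<^sub>R (Y ** Y)"] eq by simp
  moreover have "norm (Y ** Y) \<le> 1/4 * norm Y"
    by (rule order_trans[OF norm_matrix_mult_le mult_right_mono]) (use nY in auto)
  ultimately have le: "norm Y \<le> norm X" using norm_ge_zero[of X] by linarith
  have two: "2 *\<^sub>R Y = X + Y ** Y"
    using arg_cong[OF eq, of "\<lambda>Z. 2 *\<^sub>R Z"] by (simp add: scaleR_add_right)
  have sq: "(mat 1 - Y) ** (mat 1 - Y) = mat 1 - X"
    using two by (simp add: matrix_diff_ldistrib matrix_diff_rdistrib scaleR_2 algebra_simps)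
  have "sym_pos_def (mat 1 - Y)"
    unfolding sym_pos_def_def
  proof (intro conjI allI impI)
    show "transpose (mat 1 - Y) = mat 1 - Y" by (simp add: transpose_diff tY transpose_mat)
    fix v :: "real^'n" assume v: "v \<noteq> 0"
    have "\<bar>v \<bullet> (Y *v v)\<bar> \<le> norm v * norm (Y *v v)" by (rule Cauchy_Schwarz_ineq2)
    also have "\<dots> \<le> norm v * (1/4 * norm v)"
      by (intro mult_left_mono order_trans[OF norm_matrix_vector_mult_le mult_right_mono]) (use nY in auto)
    also have "\<dots> < v \<bullet> v"
      using v by (simp add: power2_norm_eq_inner[symmetric] power2_eq_square)
    finally show "v \<bullet> ((mat 1 - Y) *v v) > 0"
      by (simp add: matrix_vector_mult_diff_rdistrib inner_diff_right)
  qed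
  then show ?thesis using that sq le eq by blast
qed

lemma matrix_inv_invertible:
  fixes A :: "real^'n^'n"
  assumes "invertible A"
  shows "A ** matrix_inv A = mat 1" "matrix_inv A ** A = mat 1"
proof -
  have "A ** matrix_inv A = mat 1 \<and> matrix_inv A ** A = mat 1"
    using assms unfolding matrix_inv_def invertible_def by (rule someI_ex)
  then show "A ** matrix_inv A = mat 1" "matrix_inv A ** A = mat 1" by auto
qed

text \<open>With S = I + E and S^-1 = I + F, the identity F = - E - E F shows that F is - E up to a
  quadratic term. The root I - Y of I + F satisfies 2 Y = - F + Y^2, so Y is E / 2 up to a quadratic
  term. The threshold 1/8 gives norm F at most 1/7, within the 1/4 that
  \<open>matrix_sqrt_near_one\<close> allows.\<close>

lemma inv_sqrt_expansion:
  fixes S :: "real^'n^'n"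
  defines "E \<equiv> S - mat 1"
  assumes sym: "transpose S = S" and E: "norm E \<le> 1/8"
  shows "norm (inv_sqrt S - mat 1 + (1/2) *\<^sub>R E) \<le> 2 * (norm E)\<^sup>2"
proof -
  have SE: "S = mat 1 + E" by (simp add: E_def)
  have "inj ((*v) S)"
  proof (rule injI)
    fix x y assume "S *v x = S *v y"
    then have "x - y = - (E *v (x - y))"
      by (simp add: SE matrix_vector_mult_add_rdistrib matrix_vector_mult_diff_distrib algebra_simps)
    then have "norm (x - y) \<le> norm E * norm (x - y)"
      by (metis norm_minus_cancel norm_matrix_vector_mult_le)
    also have "\<dots> \<le> 1/8 * norm (x - y)" using E by (intro mult_right_mono) auto
    finally show "x = y" by simp
  qed
  then have inv: "invertible S"
    by (simp add: invertible_left_inverse matrix_left_invertible_injective)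
  define T where "T = matrix_inv S"
  have ST: "S ** T = mat 1" "T ** S = mat 1" using matrix_inv_invertible[OF inv] by (auto simp: T_def)
  have "transpose T = transpose T ** (S ** T)" by (simp add: ST)
  also have "\<dots> = transpose (S ** T) ** T" 
    by (simp add: matrix_mul_assoc matrix_transpose_mul sym)
  finally have symT: "transpose T = T" by (simp add: ST transpose_mat)
  define F where "F = T - mat 1"
  have F: "F = - E - E ** F"
  proof -
    have "T + E ** T = mat 1" using ST(1) by (simp add: SE matrix_add_rdistrib)
    then show ?thesis by (simp add: F_def matrix_diff_ldistrib algebra_simps)
  qed
  have EF: "norm (E ** F) \<le> norm E * norm F" by (rule norm_matrix_mult_le)
  also have "\<dots> \<le> 1/8 * norm F" using E by (intro mult_right_mono) auto
  finally have "norm F \<le> norm E + 1/8 * norm F"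
    using norm_triangle_ineq4[of "-E" "E ** F"] F by simp
  then have nF: "norm F \<le> 8/7 * norm E" by simp
  have "transpose (-F) = -F"
    using symT by (simp add: F_def transpose_diff transpose_mat)
  moreover have "norm (-F) \<le> 1/4" using nF E by simp
  ultimately obtain Y where Y: "sym_pos_def (mat 1 - Y)" "(mat 1 - Y) ** (mat 1 - Y) = mat 1 - (- F)"
    "norm Y \<le> norm (-F)" "Y = (1/2) *\<^sub>R (-F) + (1/2) *\<^sub>R (Y ** Y)"
    by (rule matrix_sqrt_near_one)
  have "inv_sqrt S = mat 1 - Y"
    by (rule inv_sqrt_eqI) (use Y in \<open>auto simp: F_def T_def\<close>)
  moreover have "Y = (1/2) *\<^sub>R E + (1/2) *\<^sub>R (E ** F) + (1/2) *\<^sub>R (Y ** Y)"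
    by (subst Y(4), subst F) (simp add: algebra_simps)
  ultimately have "inv_sqrt S - mat 1 + (1/2) *\<^sub>R E = - ((1/2) *\<^sub>R (E ** F) + (1/2) *\<^sub>R (Y ** Y))"
    by (simp add: algebra_simps)
  then have "norm (inv_sqrt S - mat 1 + (1/2) *\<^sub>R E) \<le> 1/2 * norm (E ** F) + 1/2 * norm (Y ** Y)"
    using norm_triangle_ineq[of "(1/2) *\<^sub>R (E ** F)" "(1/2) *\<^sub>R (Y ** Y)"]
    by (simp only: norm_minus_cancel) simp
  also have "\<dots> \<le> 1/2 * (norm E * (8/7 * norm E)) + 1/2 * ((8/7 * norm E) * (8/7 * norm E))"
  proof (intro add_mono mult_left_mono)
    show "norm (E ** F) \<le> norm E * (8/7 * norm E)"
      using EF mult_left_mono[OF nF norm_ge_zero[of E]] by simp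
    have "norm Y \<le> 8/7 * norm E" using Y(3) nF by simp
    then show "norm (Y ** Y) \<le> (8/7 * norm E) * (8/7 * norm E)"
      by (intro order_trans[OF norm_matrix_mult_le] mult_mono) auto
  qed auto
  \<comment> \<open>The constants add up to 4/7 + 32/49 = 60/49.\<close>
  also have "\<dots> \<le> 2 * (norm E)\<^sup>2" by (simp add: power2_eq_square)
  finally show ?thesis .
qed

subsection \<open>Measurability of the inverse square root\<close>

lemma borel_measurable_vec_nth [measurable (raw)]:
  fixes f :: "'a \<Rightarrow> ('b::euclidean_space)^'n"
  assumes "f \<in> borel_measurable M"
  shows "(\<lambda>x. f x $ i) \<in> borel_measurable M"
  by (rule borel_measurable_continuous_on[OF _ assms]) (intro continuous_intros)

lemma borel_measurable_vecI:
  fixes f :: "'a \<Rightarrow> ('b::euclidean_space)^'n"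
  assumes "\<And>i. (\<lambda>x. f x $ i) \<in> borel_measurable M"
  shows "f \<in> borel_measurable M"
proof -
  have "f = (\<lambda>x. \<Sum>i\<in>UNIV. axis i (f x $ i))"
    by (auto simp: fun_eq_iff vec_eq_iff axis_def sum.delta if_distrib cong: if_cong)
  moreover have "(\<lambda>x. axis i (f x $ i) :: 'b^'n) \<in> borel_measurable M" for i
  proof (rule borel_measurable_continuous_on[OF _ assms[of i]])
    have "continuous_on UNIV (\<lambda>y. (\<chi> j. if j = i then y else 0) :: 'b^'n)"
    proof (intro continuous_on_vec_lambda)
      show "continuous_on UNIV (\<lambda>y. if j = i then y else 0 :: 'b)" for j
        by (cases "j = i") (auto intro: continuous_intros)
    qed
    then show "continuous_on UNIV (axis i :: 'b \<Rightarrow> 'b^'n)"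
      by (simp add: axis_def[abs_def])
  qed
  then have "(\<lambda>x. \<Sum>i\<in>UNIV. axis i (f x $ i)) \<in> borel_measurable M"
    by (intro borel_measurable_sum)
  ultimately show ?thesis by simp
qed

lemma borel_measurable_matrixI:
  fixes f :: "'a \<Rightarrow> real^'n^'m"
  assumes "\<And>i j. (\<lambda>x. f x $ i $ j) \<in> borel_measurable M"
  shows "f \<in> borel_measurable M"
  by (intro borel_measurable_vecI assms)

text \<open>Cramer's rule makes the entries quotients of determinants on the regular matrices. For a
  singular matrix the predicate under the choice operator is constantly false, so the value is one
  fixed matrix.\<close>

lemma borel_measurable_matrix_inv:
  "(matrix_inv :: real^'n^'n \<Rightarrow> real^'n^'n) \<in> borel_measurable borel"
proof (rule borel_measurable_matrixI)
  fix i j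
  have nonsing: "matrix_inv A $ i $ j = det (\<chi> r k. if k = i then (axis j 1 :: real^'n) $ r else A $ r $ k) / det A"
    if "det A \<noteq> 0" for A :: "real^'n^'n"
  proof -
    have "A ** matrix_inv A = mat 1"
      using that by (intro matrix_inv_invertible) (simp add: invertible_det_nz)
    then have "A *v (matrix_inv A *v axis j 1) = axis j 1"
      by (simp add: matrix_vector_mul_assoc)
    then have "(matrix_inv A *v axis j 1) $ i = det (\<chi> r k. if k = i then (axis j 1 :: real^'n) $ r else A $ r $ k) / det A"
      unfolding cramer[OF that] by simp
    then show ?thesis
      by (simp add: matrix_vector_mul_component column_def matrix_vector_mult_basis)
  qed
  have sing: "matrix_inv A = (SOME A'. False)" if "det A = 0" for A :: "real^'n^'n"
  proof -
    have "\<not> (A ** A' = mat 1 \<and> A' ** A = mat 1)" for A'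
      using that invertible_det_nz[of A] unfolding invertible_def by auto
    then have "(\<lambda>A'. A ** A' = mat 1 \<and> A' ** A = mat 1) = (\<lambda>_. False)" by blast
    then show ?thesis by (simp only: matrix_inv_def)
  qed
  have det: "continuous_on UNIV (\<lambda>A :: real^'n^'n. det (\<chi> r k. F A r k))"
    if "\<And>r k. continuous_on UNIV (\<lambda>A. F A r k)" for F :: "real^'n^'n \<Rightarrow> 'n \<Rightarrow> 'n \<Rightarrow> real"
    unfolding det_def vec_lambda_beta
    by (intro continuous_on_sum continuous_on_mult continuous_on_const continuous_on_prod that)
  have d1 [measurable]: "(det :: real^'n^'n \<Rightarrow> real) \<in> borel_measurable borel"
    using det[of "\<lambda>A r k. A $ r $ k"] by (intro borel_measurable_continuous_onI) (simp add: continuous_intros)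
  have d2 [measurable]: "(\<lambda>A :: real^'n^'n. det (\<chi> r k. if k = i then (axis j 1 :: real^'n) $ r else A $ r $ k))
      \<in> borel_measurable borel"
  proof (intro borel_measurable_continuous_onI det)
    show "continuous_on UNIV (\<lambda>A :: real^'n^'n. if k = i then (axis j 1 :: real^'n) $ r else A $ r $ k)" for r k
      by (cases "k = i") (auto intro!: continuous_intros)
  qed
  have "(\<lambda>A. matrix_inv A $ i $ j) = (\<lambda>A :: real^'n^'n. if det A = 0 then (SOME A'. False) $ i $ j else
      det (\<chi> r k. if k = i then (axis j 1 :: real^'n) $ r else A $ r $ k) / det A)"
    using nonsing sing by (auto simp: fun_eq_iff)
  also have "\<dots> \<in> borel_measurable borel"
    by measurable
  finally show "(\<lambda>A :: real^'n^'n. matrix_inv A $ i $ j) \<in> borel_measurable borel" .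
qed

text \<open>One index bounds the matrix from above and its quadratic form from below, so countably
  many sets suffice. \<open>Suc k\<close> matters at \<open>k = 0\<close>: division by zero would
  make the lower bound 0 and admit the zero matrix.\<close>

definition coercive_matrices :: "nat \<Rightarrow> (real^'n^'n) set" where
  "coercive_matrices k = {A. transpose A = A \<and> norm A \<le> real k \<and> (\<forall>v. (v \<bullet> v) / real (Suc k) \<le> v \<bullet> (A *v v))}"

lemma compact_coercive_matrices: "compact (coercive_matrices k :: (real^'n^'n) set)"
proof -
  have c: "continuous_on UNIV (transpose :: real^'n^'n \<Rightarrow> _)"
    unfolding transpose_def by (intro continuous_intros)
  have "closed (coercive_matrices k :: (real^'n^'n) set)"
    unfolding coercive_matrices_def
    by (intro closed_Collect_conj closed_Collect_eq closed_Collect_le closed_Collect_all c continuous_intros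
        linear_continuous_on linear_conv_bounded_linear[THEN iffD1] linearI)
      (auto simp: matrix_vector_mult_add_rdistrib scaleR_matrix_vector_assoc[symmetric])
  moreover have "bounded (coercive_matrices k :: (real^'n^'n) set)"
    by (rule boundedI[of _ "real k"]) (auto simp: coercive_matrices_def)
  ultimately show ?thesis by (simp add: compact_eq_bounded_closed)
qed

text \<open>On the compact unit sphere the quadratic form attains a positive minimum
  \<open>c\<close>, and homogeneity extends the bound to all vectors.\<close>

lemma sym_pos_def_iff_coercive:
  "sym_pos_def (A :: real^'n^'n) \<longleftrightarrow> (\<exists>k. A \<in> coercive_matrices k)"
proof
  assume A: "sym_pos_def A"
  have "continuous_on (sphere 0 1) (\<lambda>v. v \<bullet> (A *v v))"
    by (intro continuous_intros matrix_vector_mult_linear_continuous_on)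
  moreover have "axis undefined 1 \<in> (sphere 0 1 :: (real^'n) set)" by simp
  ultimately obtain w where w: "w \<in> sphere 0 1" "\<And>v. v \<in> sphere 0 1 \<Longrightarrow> w \<bullet> (A *v w) \<le> v \<bullet> (A *v v)"
    using continuous_attains_inf[OF compact_sphere, of 0 1 "\<lambda>v::real^'n. v \<bullet> (A *v v)"] by blast
  define c where "c = w \<bullet> (A *v w)"
  have "w \<noteq> 0" using w(1) by auto
  then have c: "c > 0" using A by (simp add: c_def sym_pos_def_def)
  \<comment> \<open>Both summands are nonnegative, so a bound on their sum serves the norm and the
    coercivity constant at once.\<close>
  obtain k where k: "norm A + 1 / c \<le> real k" using real_arch_simple by blast
  have "(v \<bullet> v) / real (Suc k) \<le> v \<bullet> (A *v v)" for v
  proof (cases "v = 0")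
    case False
    have "c \<le> (v /\<^sub>R norm v) \<bullet> (A *v (v /\<^sub>R norm v))"
      unfolding c_def using False by (intro w) simp
    also have "\<dots> = (v \<bullet> (A *v v)) / (v \<bullet> v)"
      by (simp add: matrix_vector_mult_scaleR dot_square_norm power2_eq_square divide_simps)
    finally have 1: "c * (v \<bullet> v) \<le> v \<bullet> (A *v v)"
      using False by (simp add: pos_le_divide_eq)
    have "1 / c \<le> real k" using k norm_ge_zero[of A] by linarith
    then have "1 / c \<le> real (Suc k)" by simp
    then have "1 / real (Suc k) \<le> c" using c by (simp add: field_simps)
    then have "1 / real (Suc k) * (v \<bullet> v) \<le> c * (v \<bullet> v)" by (intro mult_right_mono) auto
    then show ?thesis using 1 by simp
  qed simp
  moreover have "norm A \<le> real k" using k c by (smt (verit) divide_pos_pos)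
  ultimately show "\<exists>k. A \<in> coercive_matrices k"
    using A by (auto simp: coercive_matrices_def sym_pos_def_def)
next
  assume "\<exists>k. A \<in> coercive_matrices k"
  then obtain k where k: "A \<in> coercive_matrices k" ..
  show "sym_pos_def A"
    unfolding sym_pos_def_def
  proof (intro conjI allI impI)
    fix v :: "real^'n" assume "v \<noteq> 0"
    then have "0 < (v \<bullet> v) / real (Suc k)" by simp
    also have "\<dots> \<le> v \<bullet> (A *v v)" using k by (simp add: coercive_matrices_def)
    finally show "0 < v \<bullet> (A *v v)" .
  qed (use k in \<open>simp add: coercive_matrices_def\<close>)
qed

text \<open>Squaring is injective and continuous on each of the compact sets \<^const>\<open>coercive_matrices\<close>,
  which exhaust the positive definite matrices, so the square root is continuous on each of their images;
  no existence statement for square roots is needed, since elsewhere \<^const>\<open>The\<close> is constant.\<close>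

lemma borel_measurable_inv_sqrt:
  "(inv_sqrt :: real^'n^'n \<Rightarrow> real^'n^'n) \<in> borel_measurable borel"
proof -
  define r where "r A = (THE B. sym_pos_def B \<and> B ** B = A)" for A :: "real^'n^'n"
  define T where "T k = (\<lambda>B. B ** B) ` (coercive_matrices k :: (real^'n^'n) set)" for k
  have r_sq: "r (B ** B) = B" if "sym_pos_def B" for B
    unfolding r_def using that by (intro the_equality) (auto intro: sym_pos_def_square_inject)
  have cont: "continuous_on UNIV (\<lambda>B :: real^'n^'n. B ** B)"
    unfolding matrix_matrix_mult_def by (intro continuous_intros)
  have r_cont: "continuous_on (T k) r" for k
  proof -
    have "continuous_on ((\<lambda>B. B ** B) ` (coercive_matrices k :: (real^'n^'n) set)) r"
      by (rule continuous_on_inv[OF continuous_on_subset[OF cont] compact_coercive_matrices])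
         (use r_sq sym_pos_def_iff_coercive in blast)+
    then show ?thesis by (simp add: T_def)
  qed
  have T_sets: "T k \<in> sets borel" for k
    unfolding T_def
    by (intro borel_closed compact_imp_closed compact_continuous_image continuous_on_subset[OF cont]
        compact_coercive_matrices) simp
  have const: "r A = (THE B. False)" if "A \<notin> (\<Union>k. T k)" for A
  proof -
    have "\<not> (sym_pos_def B \<and> B ** B = A)" for B
      using that by (auto simp: sym_pos_def_iff_coercive T_def)
    then have "(\<lambda>B. sym_pos_def B \<and> B ** B = A) = (\<lambda>_. False)" by blast
    then show ?thesis by (simp only: r_def)
  qed
  have r: "r \<in> borel_measurable borel"
  proof (rule measurable_piecewise_restrict[of "insert (- (\<Union>k. T k)) (range T)"])
    fix \<Omega> assume "\<Omega> \<in> insert (- (\<Union>k. T k)) (range T)"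
    then consider "\<Omega> = - (\<Union>k. T k)" | k where "\<Omega> = T k" by auto
    then show "r \<in> borel_measurable (restrict_space borel \<Omega>)"
    proof cases
      case 1
      have "(\<lambda>_. THE B. False) \<in> borel_measurable (restrict_space borel \<Omega>)" by simp
      then show ?thesis
        by (rule measurable_cong[THEN iffD1, rotated]) (use 1 const in \<open>auto simp: space_restrict_space\<close>)
    next
      case 2
      then show ?thesis using r_cont borel_measurable_continuous_on_restrict by blast
    qed
  qed (use T_sets in auto)
  have "inv_sqrt = (\<lambda>S. r (matrix_inv S))"
    by (simp add: fun_eq_iff inv_sqrt_def r_def)
  then show ?thesis
    using measurable_compose[OF borel_measurable_matrix_inv r] by simp
qed

subsection \<open>Exponential moments of the standard normal law\<close>

text \<open>From 1 - y \<le> exp(-y) one gets exp y - 1 - y \<le> y (exp y - 1); the second factor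
  is then bounded according to the sign of y.\<close>

lemma exp_remainder_le: "\<bar>exp y - 1 - y\<bar> \<le> y\<^sup>2 * exp \<bar>y\<bar>" for y :: real
proof -
  have nn: "0 \<le> exp y - 1 - y" using exp_ge_add_one_self[of y] by linarith
  have "(1 - y) * exp y \<le> exp (-y) * exp y"
    using exp_ge_add_one_self[of "-y"] by (intro mult_right_mono) auto
  then have up: "exp y - 1 - y \<le> y * (exp y - 1)"
    by (simp add: exp_minus algebra_simps)
  show ?thesis
  proof (cases "y \<ge> 0")
    case True
    have "exp y - 1 \<le> y * exp y" using up by (simp add: algebra_simps)
    then have "y * (exp y - 1) \<le> y * (y * exp y)" using True by (rule mult_left_mono)
    then show ?thesis using nn up True by (simp add: power2_eq_square)
  next
    case False
    have "(-y) * (1 - exp y) \<le> (-y) * (-y)"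
    proof (rule mult_left_mono)
      show "1 - exp y \<le> - y" using exp_ge_add_one_self[of y] by linarith
    qed (use False in simp)
    also have "\<dots> \<le> y\<^sup>2 * exp \<bar>y\<bar>"
      using mult_left_mono[of 1 "exp \<bar>y\<bar>" "y\<^sup>2"] by (simp add: power2_eq_square)
    finally show ?thesis using nn up by (simp add: algebra_simps)
  qed
qed

text \<open>These functions form an algebra containing the coordinates and the exponentials of
  linear forms, and all of them are integrable under the normal law. Hence their squares are
  integrable too, which is what Chebyshev asks for.\<close>

definition exp_growth :: "(real^'n \<Rightarrow> real) \<Rightarrow> bool" where
  "exp_growth f \<longleftrightarrow> f \<in> borel_measurable borel \<and> (\<exists>C a. \<forall>x. \<bar>f x\<bar> \<le> C * exp (a * norm x))"

lemma exp_growth_measurable [measurable_dest]: "exp_growth f \<Longrightarrow> f \<in> borel_measurable borel"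
  by (simp add: exp_growth_def)

lemma exp_growthE:
  assumes "exp_growth f"
  obtains C a where "0 \<le> C" "0 \<le> a" "\<And>x. \<bar>f x\<bar> \<le> C * exp (a * norm x)"
proof -
  obtain C a where Ca: "\<And>x. \<bar>f x\<bar> \<le> C * exp (a * norm x)"
    using assms by (auto simp: exp_growth_def)
  have "0 \<le> C" using Ca[of 0] by simp
  moreover have "\<bar>f x\<bar> \<le> C * exp (\<bar>a\<bar> * norm x)" for x
    using \<open>0 \<le> C\<close> by (intro order_trans[OF Ca] mult_left_mono) (auto intro: mult_right_mono)
  ultimately show ?thesis using that[of C "\<bar>a\<bar>"] by simp
qed

lemma exp_growth_const [intro, simp]: "exp_growth (\<lambda>_. c)"
  unfolding exp_growth_def by (intro conjI exI[of _ "\<bar>c\<bar>"] exI[of _ 0]) auto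

lemma exp_growth_add [intro]:
  assumes "exp_growth f" "exp_growth g"
  shows "exp_growth (\<lambda>x. f x + g x)"
proof -
  obtain C a where 1: "0 \<le> C" "\<And>x. \<bar>f x\<bar> \<le> C * exp (a * norm x)"
    using assms(1) by (elim exp_growthE) auto
  obtain D b where 2: "0 \<le> D" "\<And>x. \<bar>g x\<bar> \<le> D * exp (b * norm x)"
    using assms(2) by (elim exp_growthE) auto
  have "\<bar>f x + g x\<bar> \<le> (C + D) * exp (max a b * norm x)" for x
  proof -
    have "C * exp (a * norm x) \<le> C * exp (max a b * norm x)" "D * exp (b * norm x) \<le> D * exp (max a b * norm x)"
      using 1(1) 2(1) by (auto intro!: mult_left_mono mult_right_mono)
    then show ?thesis using 1(2)[of x] 2(2)[of x] by (simp add: algebra_simps)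
  qed
  moreover have "(\<lambda>x. f x + g x) \<in> borel_measurable borel"
    using assms by (intro borel_measurable_add exp_growth_measurable)
  ultimately show ?thesis unfolding exp_growth_def by blast
qed

lemma exp_growth_mult [intro]:
  assumes "exp_growth f" "exp_growth g"
  shows "exp_growth (\<lambda>x. f x * g x)"
proof -
  obtain C a where 1: "0 \<le> C" "\<And>x. \<bar>f x\<bar> \<le> C * exp (a * norm x)"
    using assms(1) by (elim exp_growthE) auto
  obtain D b where 2: "0 \<le> D" "\<And>x. \<bar>g x\<bar> \<le> D * exp (b * norm x)"
    using assms(2) by (elim exp_growthE) auto
  have "\<bar>f x * g x\<bar> \<le> (C * D) * exp ((a + b) * norm x)" for x
    using mult_mono[OF 1(2)[of x] 2(2)[of x]] 1(1)
    by (simp add: abs_mult algebra_simps exp_add)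
  moreover have "(\<lambda>x. f x * g x) \<in> borel_measurable borel"
    using assms by (intro borel_measurable_times exp_growth_measurable)
  ultimately show ?thesis unfolding exp_growth_def by blast
qed

lemma exp_growth_power [intro]: "exp_growth f \<Longrightarrow> exp_growth (\<lambda>x. f x ^ k)"
  by (induction k) auto

lemma exp_growth_abs [intro]: "exp_growth f \<Longrightarrow> exp_growth (\<lambda>x. \<bar>f x\<bar>)"
  unfolding exp_growth_def by auto

lemma exp_growth_exp_norm [intro]: "exp_growth (\<lambda>x. exp (a * norm x))"
  unfolding exp_growth_def by (intro conjI exI[of _ 1] exI[of _ a]) auto

lemma exp_growth_bounded:
  assumes "f \<in> borel_measurable borel" "\<And>x. \<bar>f x\<bar> \<le> exp (a * norm x)"
  shows "exp_growth f"
  unfolding exp_growth_def using assms by (intro conjI exI[of _ 1] exI[of _ a]) auto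

lemma exp_growth_nth [intro]: "exp_growth (\<lambda>x. x $ i)"
proof (rule exp_growth_bounded)
  fix x :: "real^'a"
  have "\<bar>x $ i\<bar> \<le> norm x" by (rule component_le_norm_cart)
  also have "\<dots> \<le> exp (1 * norm x)" using exp_ge_add_one_self[of "norm x"] by (simp only: mult_1)
  finally show "\<bar>x $ i\<bar> \<le> exp (1 * norm x)" .
qed simp

lemma exp_growth_exp_inner [intro]: "exp_growth (\<lambda>x. exp (t \<bullet> x))"
proof (rule exp_growth_bounded[of _ "norm t"])
  show "\<bar>exp (t \<bullet> x)\<bar> \<le> exp (norm t * norm x)" for x
    using norm_cauchy_schwarz[of t x] by simp
qed simp

lemma exp_growth_exp_abs_nth [intro]: "exp_growth (\<lambda>x. exp \<bar>x $ i\<bar>)"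
  by (rule exp_growth_bounded[of _ 1]) (use component_le_norm_cart in auto)

section \<open>Moments of the exponentially tilted normal law\<close>

locale std_mvn = prob_space +
  fixes Y :: "'a \<Rightarrow> real^'p"
  assumes distr: "distributed M lborel Y std_mvn_density"
begin

lemma Y_measurable [measurable]: "Y \<in> borel_measurable M"
  using distr by (simp add: distributed_def)

text \<open>Completing the square: translation by t turns the density times exp(t . x) into
  exp(|t|^2/2) times the density. That the density has mass 1 is read off from the assumed
  distribution on a probability space.\<close>

lemma exp_inner_moment:
  "has_bochner_integral M (\<lambda>\<omega>. exp (t \<bullet> Y \<omega>)) (exp ((norm t)\<^sup>2 / 2))"
proof -
  have dens [measurable]: "(\<lambda>x. std_mvn_density (x :: real^'p)) \<in> borel_measurable borel"
    unfolding std_mvn_density_def by measurable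
  have nn: "0 \<le> std_mvn_density x" for x :: "real^'p"
    by (simp add: std_mvn_density_def)
  have shift: "std_mvn_density (t + x) * exp (t \<bullet> (t + x)) = exp ((norm t)\<^sup>2 / 2) * std_mvn_density x" for x
  proof -
    have "- (norm (t + x))\<^sup>2 / 2 + t \<bullet> (t + x) = (norm t)\<^sup>2 / 2 - (norm x)\<^sup>2 / 2"
      by (simp add: power2_norm_eq_inner inner_add_left inner_add_right inner_commute field_simps)
    then have "exp (- (norm (t + x))\<^sup>2 / 2) * exp (t \<bullet> (t + x)) = exp ((norm t)\<^sup>2 / 2) * exp (- (norm x)\<^sup>2 / 2)"
      by (simp flip: exp_add)
    then show ?thesis by (simp add: std_mvn_density_def)
  qed
  have one: "(\<integral>\<^sup>+x. ennreal (std_mvn_density (x::real^'p)) \<partial>lborel) = 1"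
    using distributed_nn_integral[OF distr, of "\<lambda>_. 1"] by (simp add: emeasure_space_1)
  have "(\<integral>\<^sup>+\<omega>. ennreal (exp (t \<bullet> Y \<omega>)) \<partial>M)
      = (\<integral>\<^sup>+x. ennreal (std_mvn_density x) * ennreal (exp (t \<bullet> x)) \<partial>lborel)"
    by (rule distributed_nn_integral[OF distr, symmetric]) measurable
  also have "\<dots> = (\<integral>\<^sup>+x. ennreal (std_mvn_density x * exp (t \<bullet> x)) \<partial>distr lborel borel ((+) t))"
    by (simp add: lborel_distr_plus ennreal_mult nn)
  also have "\<dots> = (\<integral>\<^sup>+x. ennreal (std_mvn_density (t + x) * exp (t \<bullet> (t + x))) \<partial>lborel)"
    by (rule nn_integral_distr) measurable
  also have "\<dots> = ennreal (exp ((norm t)\<^sup>2 / 2)) * (\<integral>\<^sup>+x. ennreal (std_mvn_density (x :: real^'p)) \<partial>lborel)"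
    unfolding shift by (simp add: ennreal_mult nn nn_integral_cmult)
  finally have "(\<integral>\<^sup>+\<omega>. ennreal (exp (t \<bullet> Y \<omega>)) \<partial>M) = ennreal (exp ((norm t)\<^sup>2 / 2))"
    by (simp add: one)
  then show ?thesis
    by (intro has_bochner_integral_nn_integral) auto
qed

text \<open>Reduces the envelope to exponentials of linear forms, whose expectations are known. The
  norm is at most \<open>CARD('p)\<close> times the largest coordinate in absolute value, and both
  signs of every coordinate enter the sum.\<close>

lemma exp_norm_le:
  fixes x :: "real^'p"
  assumes "0 \<le> a"
  defines "b \<equiv> a * real CARD('p)"
  shows "exp (a * norm x) \<le> (\<Sum>i\<in>UNIV. exp (axis i b \<bullet> x) + exp (axis i (- b) \<bullet> x))"
proof -
  obtain i where i: "\<And>j. \<bar>x $ j\<bar> \<le> \<bar>x $ i\<bar>"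
  proof -
    have "Max (range (\<lambda>j. \<bar>x $ j\<bar>)) \<in> range (\<lambda>j. \<bar>x $ j\<bar>)" by (intro Max_in) auto
    then obtain i where "Max (range (\<lambda>j. \<bar>x $ j\<bar>)) = \<bar>x $ i\<bar>" by (elim imageE)
    then show ?thesis using that[of i] by (metis Max_ge finite finite_imageI rangeI)
  qed
  have "norm x \<le> (\<Sum>j\<in>UNIV. \<bar>x $ j\<bar>)" by (rule norm_le_l1_cart)
  also have "\<dots> \<le> (\<Sum>j\<in>(UNIV :: 'p set). \<bar>x $ i\<bar>)" by (intro sum_mono i)
  finally have "norm x \<le> real CARD('p) * \<bar>x $ i\<bar>" by simp
  then have "a * norm x \<le> b * \<bar>x $ i\<bar>"
    using assms(1) mult_left_mono by (fastforce simp: b_def mult.assoc)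
  then have "exp (a * norm x) \<le> exp (b * \<bar>x $ i\<bar>)" by simp
  also have "\<dots> \<le> exp (axis i b \<bullet> x) + exp (axis i (- b) \<bullet> x)"
    by (cases "x $ i \<ge> 0") (auto simp: inner_axis')
  also have "\<dots> \<le> (\<Sum>i\<in>UNIV. exp (axis i b \<bullet> x) + exp (axis i (- b) \<bullet> x))"
    by (rule member_le_sum) (auto intro: add_nonneg_nonneg)
  finally show ?thesis .
qed

lemma integrable_exp_norm: "0 \<le> a \<Longrightarrow> integrable M (\<lambda>\<omega>. exp (a * norm (Y \<omega>)))"
proof (rule Bochner_Integration.integrable_bound)
  let ?g = "\<lambda>\<omega>. \<Sum>i\<in>UNIV. exp (axis i (a * real CARD('p)) \<bullet> Y \<omega>) + exp (axis i (- (a * real CARD('p))) \<bullet> Y \<omega>)"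
  show "integrable M ?g"
    by (intro Bochner_Integration.integrable_sum Bochner_Integration.integrable_add
        integrable.intros[OF exp_inner_moment])
  show "AE \<omega> in M. norm (exp (a * norm (Y \<omega>))) \<le> norm (?g \<omega>)" if "0 \<le> a"
    using exp_norm_le[OF that] by (auto intro!: AE_I2 order_trans[OF _ abs_ge_self])
qed measurable

lemma integrable_exp_growth [intro]:
  assumes "exp_growth f"
  shows "integrable M (\<lambda>\<omega>. f (Y \<omega>))"
proof -
  note [measurable] = exp_growth_measurable[OF assms]
  obtain C a where Ca: "0 \<le> C" "0 \<le> a" "\<And>x. \<bar>f x\<bar> \<le> C * exp (a * norm x)"
    using assms by (elim exp_growthE) auto
  show ?thesis
  proof (rule Bochner_Integration.integrable_bound)
    show "integrable M (\<lambda>\<omega>. C * exp (a * norm (Y \<omega>)))"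
      using integrable_exp_norm[OF Ca(2)] by simp
    show "AE \<omega> in M. norm (f (Y \<omega>)) \<le> norm (C * exp (a * norm (Y \<omega>)))"
      using Ca(3) by (auto intro!: AE_I2 order_trans[OF _ abs_ge_self])
  qed measurable
qed

text \<open>Differentiation under the expectation brings down one coordinate factor. Starting from
  the moment generating function, it yields the tilted moments of every order.\<close>

lemma tilted_moment_derivative:
  assumes psi: "exp_growth \<psi>"
  shows "((\<lambda>s. expectation (\<lambda>\<omega>. \<psi> (Y \<omega>) * exp ((t + s *\<^sub>R axis i 1) \<bullet> Y \<omega>)))
    has_real_derivative expectation (\<lambda>\<omega>. \<psi> (Y \<omega>) * Y \<omega> $ i * exp (t \<bullet> Y \<omega>))) (at 0)"
proof -
  let ?F = "\<lambda>s. expectation (\<lambda>\<omega>. \<psi> (Y \<omega>) * exp ((t + s *\<^sub>R axis i 1) \<bullet> Y \<omega>))"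
  let ?D = "expectation (\<lambda>\<omega>. \<psi> (Y \<omega>) * Y \<omega> $ i * exp (t \<bullet> Y \<omega>))"
  \<comment> \<open>For |s| < 1 the error of the first order expansion in s is at most s^2 times
    \<open>K\<close>, an integrable bound that does not depend on s.\<close>
  define K where "K x = \<bar>\<psi> x\<bar> * exp (t \<bullet> x) * ((x $ i)\<^sup>2 * exp \<bar>x $ i\<bar>)" for x
  have K: "exp_growth K"
    unfolding K_def
    by (intro exp_growth_mult exp_growth_abs exp_growth_power psi exp_growth_exp_inner exp_growth_nth
        exp_growth_exp_abs_nth)
  have bound: "\<bar>(?F s - ?F 0) / s - ?D\<bar> \<le> \<bar>s\<bar> * expectation (\<lambda>\<omega>. K (Y \<omega>))" if s: "s \<noteq> 0" "\<bar>s\<bar> < 1" for s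
  proof -
    have I: "integrable M (\<lambda>\<omega>. \<psi> (Y \<omega>) * exp ((t + s *\<^sub>R axis i 1) \<bullet> Y \<omega>))" for s
      using integrable_exp_growth[OF exp_growth_mult[OF psi exp_growth_exp_inner]] by simp
    have I': "integrable M (\<lambda>\<omega>. \<psi> (Y \<omega>) * Y \<omega> $ i * exp (t \<bullet> Y \<omega>))"
      using integrable_exp_growth[OF exp_growth_mult[OF exp_growth_mult[OF psi exp_growth_nth] exp_growth_exp_inner]]
      by simp
    define R where "R \<omega> = \<psi> (Y \<omega>) * exp ((t + s *\<^sub>R axis i 1) \<bullet> Y \<omega>)
      - \<psi> (Y \<omega>) * exp ((t + 0 *\<^sub>R axis i 1) \<bullet> Y \<omega>) - s * (\<psi> (Y \<omega>) * Y \<omega> $ i * exp (t \<bullet> Y \<omega>))" for \<omega>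
    have "?F s - ?F 0 - s * ?D = expectation R"
      unfolding R_def using I[of s] I[of 0] I' by simp
    moreover have "\<bar>expectation R\<bar> \<le> expectation (\<lambda>\<omega>. s\<^sup>2 * K (Y \<omega>))"
    proof (rule integral_abs_bound[THEN order_trans], rule integral_mono)
      show "integrable M (\<lambda>\<omega>. \<bar>R \<omega>\<bar>)"
        unfolding R_def using I[of s] I[of 0] I' by simp
      show "integrable M (\<lambda>\<omega>. s\<^sup>2 * K (Y \<omega>))" using integrable_exp_growth[OF K] by simp
      fix \<omega>
      let ?y = "Y \<omega> $ i"
      have "R \<omega> = \<psi> (Y \<omega>) * exp (t \<bullet> Y \<omega>) * (exp (s * ?y) - 1 - s * ?y)"
        by (simp add: R_def inner_add_left exp_add inner_axis' algebra_simps)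
      moreover have "\<bar>exp (s * ?y) - 1 - s * ?y\<bar> \<le> s\<^sup>2 * (?y\<^sup>2 * exp \<bar>?y\<bar>)"
      proof -
        have "\<bar>s * ?y\<bar> \<le> 1 * \<bar>?y\<bar>" unfolding abs_mult using s by (intro mult_right_mono) auto
        then have "(s * ?y)\<^sup>2 * exp \<bar>s * ?y\<bar> \<le> (s * ?y)\<^sup>2 * exp \<bar>?y\<bar>" by (intro mult_left_mono) auto
        then show ?thesis using exp_remainder_le[of "s * ?y"] by (simp add: power_mult_distrib algebra_simps)
      qed
      ultimately have "\<bar>R \<omega>\<bar> \<le> (\<bar>\<psi> (Y \<omega>)\<bar> * exp (t \<bullet> Y \<omega>)) * (s\<^sup>2 * (?y\<^sup>2 * exp \<bar>?y\<bar>))"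
        by (simp add: abs_mult mult_left_mono)
      then show "\<bar>R \<omega>\<bar> \<le> s\<^sup>2 * K (Y \<omega>)" by (simp add: K_def algebra_simps)
    qed
    ultimately have "\<bar>?F s - ?F 0 - s * ?D\<bar> \<le> \<bar>s\<bar> * expectation (\<lambda>\<omega>. K (Y \<omega>)) * \<bar>s\<bar>"
      by (simp add: power2_eq_square abs_mult_self_eq ac_simps)
    moreover have "(?F s - ?F 0) / s - ?D = (?F s - ?F 0 - s * ?D) / s"
      using s by (simp add: field_simps)
    moreover have "0 < \<bar>s\<bar>" using s by simp
    ultimately show ?thesis
      by (simp only: abs_divide pos_divide_le_eq)
  qed
  have "((\<lambda>s. (?F s - ?F 0) / s - ?D) \<longlongrightarrow> 0) (at 0)"
  proof (rule Lim_null_comparison)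
    show "\<forall>\<^sub>F s in at 0. norm ((?F s - ?F 0) / s - ?D) \<le> \<bar>s\<bar> * expectation (\<lambda>\<omega>. K (Y \<omega>))"
      unfolding eventually_at by (rule exI[of _ 1]) (use bound in \<open>auto simp: dist_norm\<close>)
    show "((\<lambda>s. \<bar>s\<bar> * expectation (\<lambda>\<omega>. K (Y \<omega>))) \<longlongrightarrow> 0) (at 0)"
      by (auto intro!: tendsto_eq_intros)
  qed
  then have "((\<lambda>s. (?F s - ?F 0) / s) \<longlongrightarrow> ?D) (at 0)"
    by (simp add: LIM_zero_iff)
  then show ?thesis by (simp add: DERIV_def)
qed

lemma norm_shift_axis: "(norm (t + s *\<^sub>R axis i 1 :: real^'p))\<^sup>2 = (norm t)\<^sup>2 + 2 * s * t $ i + s\<^sup>2"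
  unfolding power2_norm_eq_inner
  by (simp add: inner_add_left inner_add_right inner_axis inner_axis' power2_eq_square algebra_simps)

lemma tilted_moment_0: "expectation (\<lambda>\<omega>. exp (t \<bullet> Y \<omega>)) = exp ((norm t)\<^sup>2 / 2)"
  using exp_inner_moment by (rule has_bochner_integral_integral_eq)

text \<open>Each order follows from the previous one: the closed form is differentiated directly and
  compared with \<open>tilted_moment_derivative\<close> by uniqueness of the derivative.\<close>

lemma tilted_moment_1: "expectation (\<lambda>\<omega>. Y \<omega> $ i * exp (t \<bullet> Y \<omega>)) = t $ i * exp ((norm t)\<^sup>2 / 2)"
proof -
  have "((\<lambda>s. exp ((norm (t + s *\<^sub>R axis i 1))\<^sup>2 / 2)) has_real_derivative (t $ i * exp ((norm t)\<^sup>2 / 2))) (at 0)"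
    unfolding norm_shift_axis by (auto intro!: derivative_eq_intros)
  from DERIV_unique[OF this tilted_moment_derivative[of "\<lambda>_. 1" t i, simplified, unfolded tilted_moment_0]]
  show ?thesis by simp
qed

lemma tilted_moment_2:
  "expectation (\<lambda>\<omega>. Y \<omega> $ i * Y \<omega> $ j * exp (t \<bullet> Y \<omega>))
    = ((if i = j then 1 else 0) + t $ i * t $ j) * exp ((norm t)\<^sup>2 / 2)"
proof -
  have "((\<lambda>s. (t + s *\<^sub>R axis j 1) $ i * exp ((norm (t + s *\<^sub>R axis j 1))\<^sup>2 / 2))
      has_real_derivative (((if i = j then 1 else 0) + t $ i * t $ j) * exp ((norm t)\<^sup>2 / 2))) (at 0)"
    unfolding norm_shift_axis
    by (auto intro!: derivative_eq_intros simp: axis_def algebra_simps)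
  from DERIV_unique[OF this tilted_moment_derivative[of "\<lambda>x. x $ i" t j, OF exp_growth_nth, unfolded tilted_moment_1]]
  show ?thesis by simp
qed

lemma tilted_moment_3:
  "expectation (\<lambda>\<omega>. Y \<omega> $ i * Y \<omega> $ j * Y \<omega> $ k * exp (t \<bullet> Y \<omega>))
    = ((if i = k then t $ j else 0) + (if j = k then t $ i else 0)
       + ((if i = j then 1 else 0) + t $ i * t $ j) * t $ k) * exp ((norm t)\<^sup>2 / 2)"
proof -
  have "((\<lambda>s. ((if i = j then 1 else 0) + (t + s *\<^sub>R axis k 1) $ i * (t + s *\<^sub>R axis k 1) $ j)
      * exp ((norm (t + s *\<^sub>R axis k 1))\<^sup>2 / 2)) has_real_derivative
      ((if i = k then t $ j else 0) + (if j = k then t $ i else 0)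
       + ((if i = j then 1 else 0) + t $ i * t $ j) * t $ k) * exp ((norm t)\<^sup>2 / 2)) (at 0)"
    unfolding norm_shift_axis
    by (auto intro!: derivative_eq_intros simp: axis_def algebra_simps)
  from DERIV_unique[OF this tilted_moment_derivative[of "\<lambda>x. x $ i * x $ j" t k,
      OF exp_growth_mult[OF exp_growth_nth exp_growth_nth], unfolded tilted_moment_2]]
  show ?thesis by simp
qed

end

subsection \<open>Taylor estimates\<close>

text \<open>A first order expansion in the small parameter \<open>\<eta>\<close>. One constant
  governs value, linear term and error, so that constants simply multiply when expansions
  do.\<close>

definition expands :: "real \<Rightarrow> real \<Rightarrow> real \<Rightarrow> real \<Rightarrow> real \<Rightarrow> bool" where
  "expands A \<eta> P P0 P1 \<longleftrightarrow> \<bar>P0\<bar> \<le> A \<and> \<bar>P1\<bar> \<le> A * \<eta> \<and> \<bar>P - P0 - P1\<bar> \<le> A * \<eta>\<^sup>2"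

lemma expands_mono:
  assumes "expands A \<eta> P P0 P1" "A \<le> A'" "0 \<le> \<eta>"
  shows "expands A' \<eta> P P0 P1"
proof -
  have "A * \<eta> \<le> A' * \<eta>" "A * \<eta>\<^sup>2 \<le> A' * \<eta>\<^sup>2"
    using assms by (auto intro: mult_right_mono)
  then show ?thesis using assms unfolding expands_def by linarith
qed

text \<open>The factor 6 counts the products left in the remainder, all of order at least two;
  \<open>\<eta> \<le> 1\<close> absorbs the higher powers.\<close>

lemma expands_mult:
  assumes eta: "0 \<le> \<eta>" "\<eta> \<le> 1"
    and P: "expands A \<eta> P P0 P1" and Q: "expands A' \<eta> Q Q0 Q1"
  shows "expands (6 * A * A') \<eta> (P * Q) (P0 * Q0) (P0 * Q1 + P1 * Q0)"
proof -
  define p where "p = P - P0 - P1"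
  define q where "q = Q - Q0 - Q1"
  have P': "\<bar>P0\<bar> \<le> A" "\<bar>P1\<bar> \<le> A * \<eta>" "\<bar>p\<bar> \<le> A * \<eta>\<^sup>2"
    and Q': "\<bar>Q0\<bar> \<le> A'" "\<bar>Q1\<bar> \<le> A' * \<eta>" "\<bar>q\<bar> \<le> A' * \<eta>\<^sup>2"
    using P Q by (auto simp: expands_def p_def q_def)
  have A: "0 \<le> A" "0 \<le> A'" using P'(1) Q'(1) by linarith+
  have e2: "\<eta>\<^sup>2 \<le> 1" using eta by (simp add: power_le_one)
  then have e3: "\<eta> * \<eta>\<^sup>2 \<le> \<eta>\<^sup>2" "\<eta>\<^sup>2 * \<eta> \<le> \<eta>\<^sup>2" "\<eta>\<^sup>2 * \<eta>\<^sup>2 \<le> \<eta>\<^sup>2"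
    using eta mult_right_mono[OF eta(2), of "\<eta>\<^sup>2"] mult_right_mono[of "\<eta>\<^sup>2" 1 "\<eta>\<^sup>2"]
    by (simp_all only: mult.commute mult_1 zero_le_power2 simp_thms True_implies_equals)
  have m: "\<bar>x * y\<bar> \<le> A * A' * c" if "\<bar>x\<bar> \<le> A * a" "\<bar>y\<bar> \<le> A' * b" "a * b \<le> c" "0 \<le> a" "0 \<le> b" for x y a b c
  proof -
    have "\<bar>x * y\<bar> \<le> (A * a) * (A' * b)"
      unfolding abs_mult using that A by (intro mult_mono) auto
    also have "\<dots> = A * A' * (a * b)" by simp
    also have "\<dots> \<le> A * A' * c" using that A by (intro mult_left_mono) auto
    finally show ?thesis .
  qed
  have b00: "\<bar>P0 * Q0\<bar> \<le> A * A' * 1" by (rule m[where a=1 and b=1]) (use P' Q' in auto)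
  have b01: "\<bar>P0 * Q1\<bar> \<le> A * A' * \<eta>" by (rule m[where a=1 and b=\<eta>]) (use P' Q' eta in auto)
  have b10: "\<bar>P1 * Q0\<bar> \<le> A * A' * \<eta>" by (rule m[where a=\<eta> and b=1]) (use P' Q' eta in auto)
  have b11: "\<bar>P1 * Q1\<bar> \<le> A * A' * \<eta>\<^sup>2"
    by (rule m[where a=\<eta> and b=\<eta>]) (use P' Q' eta in \<open>auto simp: power2_eq_square\<close>)
  have b0q: "\<bar>P0 * q\<bar> \<le> A * A' * \<eta>\<^sup>2" by (rule m[where a=1 and b="\<eta>\<^sup>2"]) (use P' Q' eta in auto)
  have b1q: "\<bar>P1 * q\<bar> \<le> A * A' * \<eta>\<^sup>2" by (rule m[where a=\<eta> and b="\<eta>\<^sup>2"]) (use P' Q' eta e3 in auto)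
  have bp0: "\<bar>p * Q0\<bar> \<le> A * A' * \<eta>\<^sup>2" by (rule m[where a="\<eta>\<^sup>2" and b=1]) (use P' Q' eta in auto)
  have bp1: "\<bar>p * Q1\<bar> \<le> A * A' * \<eta>\<^sup>2" by (rule m[where a="\<eta>\<^sup>2" and b=\<eta>]) (use P' Q' eta e3 in auto)
  have bpq: "\<bar>p * q\<bar> \<le> A * A' * \<eta>\<^sup>2" by (rule m[where a="\<eta>\<^sup>2" and b="\<eta>\<^sup>2"]) (use P' Q' eta e3 in auto)
  have eq: "P * Q - P0 * Q0 - (P0 * Q1 + P1 * Q0) = P1 * Q1 + P0 * q + P1 * q + p * Q0 + p * Q1 + p * q"
    by (simp add: p_def q_def algebra_simps)
  have K: "0 \<le> A * A'" "0 \<le> A * A' * \<eta>" using A eta by auto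
  have "\<bar>P0 * Q0\<bar> \<le> 6 * A * A'" using b00 K(1) by linarith
  moreover have "\<bar>P0 * Q1 + P1 * Q0\<bar> \<le> A * A' * \<eta> + A * A' * \<eta>"
    by (intro abs_triangle_ineq[THEN order_trans] add_mono b01 b10)
  then have "\<bar>P0 * Q1 + P1 * Q0\<bar> \<le> 6 * A * A' * \<eta>" using K(2) by linarith
  moreover have "\<bar>P1 * Q1 + P0 * q + P1 * q + p * Q0 + p * Q1 + p * q\<bar>
      \<le> A * A' * \<eta>\<^sup>2 + A * A' * \<eta>\<^sup>2 + A * A' * \<eta>\<^sup>2 + A * A' * \<eta>\<^sup>2 + A * A' * \<eta>\<^sup>2 + A * A' * \<eta>\<^sup>2"
    by (intro abs_triangle_ineq[THEN order_trans] add_mono b11 b0q b1q bp0 bp1 bpq)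
  then have "\<bar>P1 * Q1 + P0 * q + P1 * q + p * Q0 + p * Q1 + p * q\<bar> \<le> 6 * A * A' * \<eta>\<^sup>2" by linarith
  ultimately show ?thesis unfolding expands_def eq by blast
qed

lemma one_plus_le_exp: "1 + x \<le> exp x" "x \<le> exp x" for x :: real
  using exp_ge_add_one_self[of x] by linarith+

text \<open>36 = 6 * 6 comes from two uses of \<open>expands_mult\<close>, one for each coordinate
  factor in the Hessian; the rest is the constant of \<open>expands_exp\<close>.\<close>

definition perturbation_const :: "real^'p \<Rightarrow> real" where
  "perturbation_const t = 36 * ((1 + norm t)\<^sup>2 * exp (norm t))"

text \<open>The exponential factor contributes \<open>2 * norm t + 2\<close>, and each of up to two
  coordinate factors contributes 1.\<close>

definition envelope_exponent :: "real^'p \<Rightarrow> real" where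
  "envelope_exponent t = 2 * norm t + 4"

context
  fixes t x c :: "real^'p" and D :: "real^'p^'p" and \<eta> :: real
  assumes eta: "norm D + norm c \<le> \<eta>" "\<eta> \<le> 1"
begin

private lemma eta0: "0 \<le> \<eta>"
  using eta(1) norm_ge_zero[of D] norm_ge_zero[of c] by linarith

private lemma norm_shift_le: "norm (D *v x + c) \<le> \<eta> * (1 + norm x)"
proof -
  have "norm (D *v x + c) \<le> norm D * norm x + norm c"
    using norm_triangle_ineq[of "D *v x" c] norm_matrix_vector_mult_le[of D x] by linarith
  also have "\<dots> \<le> \<eta> * norm x + \<eta> * 1"
  proof (intro add_mono mult_right_mono)
    show "norm D \<le> \<eta>" using eta(1) norm_ge_zero[of c] by linarith
    show "norm c \<le> \<eta> * 1" using eta(1) norm_ge_zero[of D] by linarith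
  qed simp
  finally show ?thesis by (simp add: algebra_simps)
qed

private lemma norm_shift_le_exp: "norm (D *v x + c) \<le> exp (norm x) * \<eta>"
  using norm_shift_le mult_left_mono[OF one_plus_le_exp(1)[of "norm x"] eta0] by (simp add: mult.commute)

private lemma expands_nth: "expands (exp (norm x)) \<eta> ((x + (D *v x + c)) $ k) (x $ k) ((D *v x + c) $ k)"
proof -
  have "\<bar>x $ k\<bar> \<le> exp (norm x)"
    using component_le_norm_cart[of x k] one_plus_le_exp(2)[of "norm x"] by linarith
  moreover have "\<bar>(D *v x + c) $ k\<bar> \<le> exp (norm x) * \<eta>"
    using component_le_norm_cart[of "D *v x + c" k] norm_shift_le_exp by linarith
  ultimately show ?thesis unfolding expands_def by simp
qed

text \<open>With b = t . (D x + c) the error is exp(t . x) (exp b - 1 - b), and |exp b - 1 - b|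
  \<le> b^2 exp |b|. The growth rates in |x| are |t| from exp(t . x), |t| from exp |b|, and 2 from
  b^2 through 1 + |x| \<le> exp |x|; together they give \<open>2 * norm t + 2\<close>.\<close>

private lemma expands_exp:
  "expands ((1 + norm t)\<^sup>2 * exp (norm t) * exp ((2 * norm t + 2) * norm x)) \<eta>
    (exp (t \<bullet> (x + (D *v x + c)))) (exp (t \<bullet> x)) (exp (t \<bullet> x) * (t \<bullet> (D *v x + c)))"
proof -
  define T where "T = norm t"
  define b where "b = t \<bullet> (D *v x + c)"
  define A where "A = (1 + T)\<^sup>2 * exp T * exp ((2 * T + 2) * norm x)"
  have T: "0 \<le> T" by (simp add: T_def)
  have b1: "\<bar>b\<bar> \<le> T * (\<eta> * (1 + norm x))"
    unfolding b_def T_def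
    using Cauchy_Schwarz_ineq2[of t "D *v x + c"] mult_left_mono[OF norm_shift_le norm_ge_zero[of t]] by linarith
  have b2: "\<bar>b\<bar> \<le> T * (exp (norm x) * \<eta>)"
    unfolding b_def T_def
    using Cauchy_Schwarz_ineq2[of t "D *v x + c"] mult_left_mono[OF norm_shift_le_exp norm_ge_zero[of t]] by linarith
  have "T * (\<eta> * (1 + norm x)) \<le> T * (1 * (1 + norm x))"
    using T eta by (intro mult_left_mono mult_right_mono) auto
  then have b3: "exp \<bar>b\<bar> \<le> exp T * exp (T * norm x)"
    using b1 by (simp flip: exp_add add: algebra_simps)
  have ea: "exp (t \<bullet> x) \<le> exp (T * norm x)"
    using norm_cauchy_schwarz[of t x] by (simp add: T_def)
  have T1: "1 \<le> (1 + T)\<^sup>2" "T \<le> (1 + T)\<^sup>2" "T\<^sup>2 \<le> (1 + T)\<^sup>2"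
    using T by (auto simp: power2_eq_square algebra_simps)
  have eT: "1 \<le> exp T" using T by simp
  have big: "a * e \<le> A" if "0 \<le> a" "a \<le> (1 + T)\<^sup>2" "e \<le> exp T * exp ((2 * T + 2) * norm x)" "0 \<le> e" for a e
    unfolding A_def mult.assoc using that by (intro mult_mono) auto
  have ex: "exp (k * norm x) \<le> exp T * exp ((2 * T + 2) * norm x)" if "k \<le> 2 * T + 2" for k
  proof -
    have "k * norm x \<le> (2 * T + 2) * norm x" using that by (intro mult_right_mono) auto
    then have "1 * exp (k * norm x) \<le> exp T * exp ((2 * T + 2) * norm x)"
      using eT by (intro mult_mono) auto
    then show ?thesis by simp
  qed
  have 0: "exp (t \<bullet> x) \<le> A"
    using ea big[of 1 "exp (T * norm x)"] T1(1) T ex[of T] by (intro order_trans[OF ea]) simp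
  have "exp (t \<bullet> x) * \<bar>b\<bar> \<le> exp (T * norm x) * (T * (exp (norm x) * \<eta>))"
    using ea b2 by (intro mult_mono) auto
  also have "\<dots> = T * exp ((T + 1) * norm x) * \<eta>"
    by (simp add: exp_add algebra_simps)
  also have "\<dots> \<le> A * \<eta>"
    using T T1 ex[of "T + 1"] by (intro mult_right_mono big eta0) auto
  finally have 1: "exp (t \<bullet> x) * \<bar>b\<bar> \<le> A * \<eta>" .
  have "\<bar>exp b - 1 - b\<bar> \<le> b\<^sup>2 * exp \<bar>b\<bar>" by (rule exp_remainder_le)
  also have "\<dots> \<le> (T * (exp (norm x) * \<eta>))\<^sup>2 * (exp T * exp (T * norm x))"
    using b2 b3 by (intro mult_mono power2_le_iff_abs_le[THEN iffD2]) auto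
  finally have "exp (t \<bullet> x) * \<bar>exp b - 1 - b\<bar> \<le> exp (T * norm x) * ((T * (exp (norm x) * \<eta>))\<^sup>2 * (exp T * exp (T * norm x)))"
    using ea by (intro mult_mono) auto
  also have "\<dots> = T\<^sup>2 * (exp T * exp ((2 * T + 2) * norm x)) * \<eta>\<^sup>2"
  proof -
    have "exp ((2 * T + 2) * norm x) = exp (T * norm x) * exp (T * norm x) * (exp (norm x) * exp (norm x))"
      by (simp add: mult_exp_exp algebra_simps)
    then show ?thesis by (simp add: power2_eq_square)
  qed
  also have "\<dots> \<le> A * \<eta>\<^sup>2"
    using T1 by (intro mult_right_mono big) auto
  finally have 2: "exp (t \<bullet> x) * \<bar>exp b - 1 - b\<bar> \<le> A * \<eta>\<^sup>2" .
  have eq: "exp (t \<bullet> (x + (D *v x + c))) - exp (t \<bullet> x) - exp (t \<bullet> x) * b = exp (t \<bullet> x) * (exp b - 1 - b)"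
    by (simp add: b_def inner_add_right exp_add algebra_simps)
  show ?thesis
    unfolding expands_def T_def[symmetric] A_def[symmetric] b_def[symmetric] eq
    using 0 1 2 by (simp add: abs_mult)
qed

text \<open>\<open>l\<close> is the number of coordinate factors and \<open>k\<close> is 6 to the
  power \<open>l\<close>; the cases in use are (1, 0), (6, 1) and (36, 2).\<close>

private lemma bound_mono:
  assumes "expands (k * ((1 + norm t)\<^sup>2 * exp (norm t) * exp ((2 * norm t + 2) * norm x)) * exp (l * norm x)) \<eta> P P0 P1"
    "k \<le> 36" "0 \<le> k" "l \<le> 2"
  shows "\<bar>P - P0 - P1\<bar> \<le> perturbation_const t * exp (envelope_exponent t * norm x) * \<eta>\<^sup>2"
proof -
  have "exp ((2 * norm t + 2) * norm x) * exp (l * norm x) = exp ((2 * norm t + 2 + l) * norm x)"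
    by (simp add: mult_exp_exp algebra_simps)
  also have "\<dots> \<le> exp (envelope_exponent t * norm x)"
    unfolding envelope_exponent_def exp_le_cancel_iff using assms by (intro mult_right_mono) auto
  finally have e: "exp ((2 * norm t + 2) * norm x) * exp (l * norm x) \<le> exp (envelope_exponent t * norm x)" .
  have "k * ((1 + norm t)\<^sup>2 * exp (norm t) * exp ((2 * norm t + 2) * norm x)) * exp (l * norm x)
      = (k * ((1 + norm t)\<^sup>2 * exp (norm t))) * (exp ((2 * norm t + 2) * norm x) * exp (l * norm x))"
    by simp
  also have "\<dots> \<le> perturbation_const t * exp (envelope_exponent t * norm x)"
    unfolding perturbation_const_def by (intro mult_mono e assms mult_right_mono) auto
  finally show ?thesis
    using expands_mono[OF assms(1) _ eta0] by (simp add: expands_def)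
qed

lemma perturb_exp:
  "\<bar>exp (t \<bullet> (x + (D *v x + c))) - exp (t \<bullet> x) - exp (t \<bullet> x) * (t \<bullet> (D *v x + c))\<bar>
    \<le> perturbation_const t * exp (envelope_exponent t * norm x) * \<eta>\<^sup>2"
  by (rule bound_mono[of 1 0]) (use expands_exp in simp_all)

lemma perturb_exp_nth:
  "\<bar>exp (t \<bullet> (x + (D *v x + c))) * (x + (D *v x + c)) $ k - exp (t \<bullet> x) * x $ k
     - (exp (t \<bullet> x) * (D *v x + c) $ k + exp (t \<bullet> x) * (t \<bullet> (D *v x + c)) * x $ k)\<bar>
    \<le> perturbation_const t * exp (envelope_exponent t * norm x) * \<eta>\<^sup>2"
  by (rule bound_mono[of 6 1]) (use expands_mult[OF eta0 eta(2) expands_exp expands_nth] in simp_all)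

lemma perturb_exp_nth_nth:
  "\<bar>exp (t \<bullet> (x + (D *v x + c))) * (x + (D *v x + c)) $ k * (x + (D *v x + c)) $ l - exp (t \<bullet> x) * x $ k * x $ l
     - (exp (t \<bullet> x) * x $ k * (D *v x + c) $ l
       + (exp (t \<bullet> x) * (D *v x + c) $ k + exp (t \<bullet> x) * (t \<bullet> (D *v x + c)) * x $ k) * x $ l)\<bar>
    \<le> perturbation_const t * exp (envelope_exponent t * norm x) * \<eta>\<^sup>2"
proof (rule bound_mono[of 36 2])
  have "exp (2 * norm x) = exp (norm x) * exp (norm x)" by (simp add: mult_exp_exp)
  then show "expands (36 * ((1 + norm t)\<^sup>2 * exp (norm t) * exp ((2 * norm t + 2) * norm x)) * exp (2 * norm x)) \<eta>
     (exp (t \<bullet> (x + (D *v x + c))) * (x + (D *v x + c)) $ k * (x + (D *v x + c)) $ l)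
     (exp (t \<bullet> x) * x $ k * x $ l)
     (exp (t \<bullet> x) * x $ k * (D *v x + c) $ l
       + (exp (t \<bullet> x) * (D *v x + c) $ k + exp (t \<bullet> x) * (t \<bullet> (D *v x + c)) * x $ k) * x $ l)"
    using expands_mult[OF eta0 eta(2) expands_mult[OF eta0 eta(2) expands_exp expands_nth[of k]] expands_nth[of l]]
    by (simp add: ac_simps)
qed auto

end

subsection \<open>Uniform expansion of the standardised sample\<close>

text \<open>The pair makes size and sample a single variable, so one filter can carry limits in the
  size that are uniform in the sample.\<close>

definition sample_avg :: "('b \<Rightarrow> real) \<Rightarrow> nat \<times> (nat \<Rightarrow> 'b) \<Rightarrow> real" where
  "sample_avg f z = (\<Sum>i<fst z. f (snd z i)) / real (fst z)"

lemma sample_avg_add: "sample_avg (\<lambda>x. f x + g x) z = sample_avg f z + sample_avg g z"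
  by (simp add: sample_avg_def sum.distrib add_divide_distrib)

lemma sample_avg_diff: "sample_avg (\<lambda>x. f x - g x) z = sample_avg f z - sample_avg g z"
  by (simp add: sample_avg_def sum_subtractf diff_divide_distrib)

lemma sample_avg_cmult: "sample_avg (\<lambda>x. c * f x) z = c * sample_avg f z"
  by (simp add: sample_avg_def sum_distrib_left)

lemma sample_avg_multc: "sample_avg (\<lambda>x. f x * c) z = sample_avg f z * c"
  by (simp add: sample_avg_def sum_distrib_right)

lemma sample_avg_sum: "sample_avg (\<lambda>x. \<Sum>j\<in>J. f j x) z = (\<Sum>j\<in>J. sample_avg (f j) z)"
  by (simp add: sample_avg_def sum_divide_distrib) (rule sum.swap)

lemma sample_avg_const: "fst z > 0 \<Longrightarrow> sample_avg (\<lambda>x. c) z = c"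
  by (simp add: sample_avg_def)

lemma sample_avg_abs_le:
  assumes "\<And>x. \<bar>f x\<bar> \<le> g x"
  shows "\<bar>sample_avg f z\<bar> \<le> sample_avg g z"
proof -
  have "\<bar>\<Sum>i<fst z. f (snd z i)\<bar> \<le> (\<Sum>i<fst z. g (snd z i))"
    by (rule order_trans[OF sum_abs]) (intro sum_mono assms)
  then show ?thesis by (simp add: sample_avg_def abs_divide divide_right_mono)
qed

abbreviation root_rate :: "nat \<times> 'b \<Rightarrow> real" where
  "root_rate z \<equiv> 1 / sqrt (real (fst z))"

text \<open>This is 1 / n, kept as a product so that two bounds of order \<open>root_rate\<close>
  combine by the Landau product rule.\<close>

abbreviation rate :: "nat \<times> 'b \<Rightarrow> real" where
  "rate z \<equiv> root_rate z * root_rate z"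

text \<open>The contribution of one observation \<open>x\<close> to the \<open>k\<close>-th component of the first order effect of
  standardisation, where \<open>\<mu>0\<close> and \<open>\<mu> j\<close> are the means of the weight and of the weight times the
  \<open>j\<close>-th coordinate.\<close>

definition influence :: "real \<Rightarrow> ('p \<Rightarrow> real) \<Rightarrow> 'p \<Rightarrow> real^'p \<Rightarrow> real" where
  "influence \<mu>0 \<mu> k x = (\<Sum>j\<in>UNIV. (x $ k * x $ j - (if k = j then 1 else 0)) * (- (1/2) * \<mu> j)) - x $ k * \<mu>0"

text \<open>All that the expansion uses about the sample. Weights up to degree three occur because
  perturbing the exponential in the Hessian multiplies x_i x_j by a further coordinate. The envelope
  average need only be bounded, since it is multiplied by a quadratic error.\<close>

locale regular_samples =
  fixes F :: "(nat \<times> (nat \<Rightarrow> real^'p)) filter" and t :: "real^'p"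
  assumes size: "filterlim fst at_top F"
    and avg_nth: "\<And>k. sample_avg (\<lambda>x. x $ k) \<in> O[F](root_rate)"
    and avg_nth2: "\<And>k l. (\<lambda>z. sample_avg (\<lambda>x. x $ k * x $ l) z - (if k = l then 1 else 0)) \<in> O[F](root_rate)"
    and avg_exp: "(\<lambda>z. sample_avg (\<lambda>x. exp (t \<bullet> x)) z - exp ((norm t)\<^sup>2 / 2)) \<in> O[F](root_rate)"
    and avg_exp_nth: "\<And>k. (\<lambda>z. sample_avg (\<lambda>x. exp (t \<bullet> x) * x $ k) z - t $ k * exp ((norm t)\<^sup>2 / 2)) \<in> O[F](root_rate)"
    and avg_exp_nth2: "\<And>k l. (\<lambda>z. sample_avg (\<lambda>x. exp (t \<bullet> x) * x $ k * x $ l) z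
        - ((if k = l then 1 else 0) + t $ k * t $ l) * exp ((norm t)\<^sup>2 / 2)) \<in> O[F](root_rate)"
    and avg_exp_nth3: "\<And>i j k. (\<lambda>z. sample_avg (\<lambda>x. exp (t \<bullet> x) * x $ i * x $ j * x $ k) z
        - ((if i = k then t $ j else 0) + (if j = k then t $ i else 0)
           + ((if i = j then 1 else 0) + t $ i * t $ j) * t $ k) * exp ((norm t)\<^sup>2 / 2)) \<in> O[F](root_rate)"
    and avg_envelope: "sample_avg (\<lambda>x. exp (envelope_exponent t * norm x)) \<in> O[F](\<lambda>_. 1)"
begin

lemma eventually_pos: "\<forall>\<^sub>F z in F. fst z > 0"
proof -
  have "\<forall>\<^sub>F z in F. 1 \<le> fst z" using size by (simp add: filterlim_at_top)
  then show ?thesis by eventually_elim simp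
qed

lemma root_rate_tendsto: "(root_rate \<longlongrightarrow> 0) F"
proof -
  have "((\<lambda>n. 1 / sqrt (real n)) \<longlongrightarrow> 0) at_top"
    by (intro real_tendsto_divide_at_top[OF tendsto_const] filterlim_compose[OF sqrt_at_top] filterlim_real_sequentially)
  then show ?thesis using size by (rule filterlim_compose)
qed

lemma root_rate_bigo_1: "root_rate \<in> O[F](\<lambda>_. 1)"
proof (rule bigoI[of _ 1])
  have "\<forall>\<^sub>F z in F. root_rate z < 1"
    by (rule order_tendstoD(2)[OF root_rate_tendsto]) simp
  then show "\<forall>\<^sub>F z in F. norm (root_rate z) \<le> 1 * norm (1 :: real)"
    by eventually_elim simp
qed

lemma bigo_root_rate_imp_1: "f \<in> O[F](root_rate) \<Longrightarrow> f \<in> O[F](\<lambda>_. 1)"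
  by (rule landau_o.big_trans[OF _ root_rate_bigo_1])

lemma bigo_rate_imp_root: "f \<in> O[F](rate) \<Longrightarrow> f \<in> O[F](root_rate)"
proof -
  have "rate \<in> O[F](\<lambda>z. root_rate z * 1)"
    by (intro landau_o.big.mult root_rate_bigo_1) simp
  then show "f \<in> O[F](rate) \<Longrightarrow> f \<in> O[F](root_rate)"
    using landau_o.big_trans by (simp only: mult_1_right) blast
qed

lemma bigo_mult_1: "f \<in> O[F](r) \<Longrightarrow> g \<in> O[F](\<lambda>_. 1) \<Longrightarrow> (\<lambda>z. f z * g z) \<in> O[F](r)"
  using landau_o.big.mult[of f F r g "\<lambda>_. 1"] by simp

lemma bigo_1_mult: "f \<in> O[F](\<lambda>_. 1) \<Longrightarrow> g \<in> O[F](r) \<Longrightarrow> (\<lambda>z. f z * g z) \<in> O[F](r)"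
  using landau_o.big.mult[of f F "\<lambda>_. 1" g r] by simp

lemma bigo_multc: "f \<in> O[F](r) \<Longrightarrow> (\<lambda>z. f z * c) \<in> O[F](r)"
  by (intro bigo_mult_1) auto

lemma bigo_cmult: "f \<in> O[F](r) \<Longrightarrow> (\<lambda>z. c * f z) \<in> O[F](r)"
  by (intro bigo_1_mult) auto

lemma bigo_rate_mult: "f \<in> O[F](root_rate) \<Longrightarrow> g \<in> O[F](root_rate) \<Longrightarrow> (\<lambda>z. f z * g z) \<in> O[F](rate)"
  by (rule landau_o.big.mult)

lemma bigo_tendsto:
  assumes "f \<in> O[F](root_rate)"
  shows "(f \<longlongrightarrow> 0) F"
proof -
  have "root_rate \<in> o[F](\<lambda>_. 1)"
    using root_rate_tendsto by (intro smalloI_tendsto) auto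
  then have "f \<in> o[F](\<lambda>_. 1)"
    using assms landau_o.big_small_trans by blast
  then show ?thesis by (auto dest: smalloD_tendsto)
qed

abbreviation mean_at :: "nat \<times> (nat \<Rightarrow> real^'p) \<Rightarrow> real^'p" where
  "mean_at z \<equiv> sample_mean (fst z) (snd z)"

abbreviation cov_at :: "nat \<times> (nat \<Rightarrow> real^'p) \<Rightarrow> real^'p^'p" where
  "cov_at z \<equiv> sample_cov (fst z) (snd z)"

definition D :: "nat \<times> (nat \<Rightarrow> real^'p) \<Rightarrow> real^'p^'p" where
  "D z = inv_sqrt (cov_at z) - mat 1"

definition c :: "nat \<times> (nat \<Rightarrow> real^'p) \<Rightarrow> real^'p" where
  "c z = - (inv_sqrt (cov_at z) *v mean_at z)"

lemma scaled_residual_eq: "scaled_residual (fst z) (snd z) i = snd z i + (D z *v snd z i + c z)"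
  by (simp add: scaled_residual_def D_def c_def matrix_vector_mult_diff_distrib
      matrix_vector_mult_diff_rdistrib)

lemma mean_nth: "mean_at z $ k = sample_avg (\<lambda>x. x $ k) z"
  by (simp add: sample_mean_def sample_avg_def)

lemma cov_nth: "cov_at z $ k $ l
  = sample_avg (\<lambda>x. x $ k * x $ l) z - sample_avg (\<lambda>x. x $ k) z * sample_avg (\<lambda>x. x $ l) z"
proof (cases "fst z = 0")
  case False
  have "cov_at z $ k $ l = sample_avg (\<lambda>x. (x $ k - mean_at z $ k) * (x $ l - mean_at z $ l)) z"
    by (simp add: sample_cov_def sample_avg_def outer_def)
  also have "\<dots> = sample_avg (\<lambda>x. x $ k * x $ l - mean_at z $ k * x $ l - x $ k * mean_at z $ l
      + mean_at z $ k * mean_at z $ l) z"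
    by (simp add: algebra_simps)
  also have "\<dots> = sample_avg (\<lambda>x. x $ k * x $ l) z - mean_at z $ k * mean_at z $ l"
    using False
    by (simp add: sample_avg_add sample_avg_diff sample_avg_cmult sample_avg_multc sample_avg_const mean_nth)
  finally show ?thesis by (simp add: mean_nth)
qed (simp add: sample_cov_def sample_avg_def)

lemma transpose_cov: "transpose (cov_at z) = cov_at z"
  by (simp add: vec_eq_iff transpose_def cov_nth mult.commute)

definition E :: "nat \<times> (nat \<Rightarrow> real^'p) \<Rightarrow> real^'p^'p" where
  "E z = cov_at z - mat 1"

definition W :: "'p \<Rightarrow> 'p \<Rightarrow> nat \<times> (nat \<Rightarrow> real^'p) \<Rightarrow> real" where
  "W k l z = sample_avg (\<lambda>x. x $ k * x $ l) z - (if k = l then 1 else 0)"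

lemma W_bigo: "W k l \<in> O[F](root_rate)"
  unfolding W_def[abs_def] by (rule avg_nth2)

lemma E_nth: "E z $ k $ l = W k l z - sample_avg (\<lambda>x. x $ k) z * sample_avg (\<lambda>x. x $ l) z"
  by (simp add: E_def W_def cov_nth mat_def)

lemma E_W_bigo: "(\<lambda>z. E z $ k $ l - W k l z) \<in> O[F](rate)"
  unfolding E_nth using bigo_rate_mult[OF avg_nth avg_nth] by simp

lemma E_bigo: "(\<lambda>z. E z $ k $ l) \<in> O[F](root_rate)"
  using sum_in_bigo(1)[OF bigo_rate_imp_root[OF E_W_bigo] W_bigo, of k l k l] by simp

lemma norm_matrix_bigo:
  assumes "\<And>i j. (\<lambda>z. A z $ i $ j) \<in> O[F](r)"
  shows "(\<lambda>z. norm (A z :: real^'p^'p)) \<in> O[F](r)"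
proof -
  have "(\<lambda>z. norm (A z)) \<in> O[F](\<lambda>z. \<Sum>i\<in>UNIV. \<Sum>j\<in>UNIV. \<bar>A z $ i $ j\<bar>)"
    by (intro bigoI[of _ 1] always_eventually allI) (use norm_matrix_le_sum in \<open>auto intro: order_trans[OF _ abs_ge_self]\<close>)
  moreover have "(\<lambda>z. \<Sum>i\<in>UNIV. \<Sum>j\<in>UNIV. \<bar>A z $ i $ j\<bar>) \<in> O[F](r)"
    by (intro big_sum_in_bigo) (simp add: assms)
  ultimately show ?thesis by (rule landau_o.big_trans)
qed

lemma norm_vec_bigo:
  assumes "\<And>i. (\<lambda>z. a z $ i) \<in> O[F](r)"
  shows "(\<lambda>z. norm (a z :: real^'p)) \<in> O[F](r)"
proof -
  have "(\<lambda>z. norm (a z)) \<in> O[F](\<lambda>z. \<Sum>i\<in>UNIV. \<bar>a z $ i\<bar>)"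
    by (intro bigoI[of _ 1] always_eventually allI) (use norm_le_l1_cart in \<open>auto intro: order_trans[OF _ abs_ge_self]\<close>)
  moreover have "(\<lambda>z. \<Sum>i\<in>UNIV. \<bar>a z $ i\<bar>) \<in> O[F](r)"
    by (intro big_sum_in_bigo) (simp add: assms)
  ultimately show ?thesis by (rule landau_o.big_trans)
qed

text \<open>\<open>E\<close> tends to 0, so the covariance eventually enters the range of
  \<open>inv_sqrt_expansion\<close>. Passing from \<open>E\<close> to \<open>W\<close> costs only a
  product of two sample means.\<close>

lemma D_W_bigo: "(\<lambda>z. D z $ k $ l + 1/2 * W k l z) \<in> O[F](rate)"
proof -
  have nE: "(\<lambda>z. norm (E z)) \<in> O[F](root_rate)" by (rule norm_matrix_bigo[OF E_bigo])
  have "\<forall>\<^sub>F z in F. norm (E z) < 1/8"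
    by (rule order_tendstoD(2)[OF bigo_tendsto[OF nE]]) simp
  then have "\<forall>\<^sub>F z in F. norm (D z $ k $ l + 1/2 * E z $ k $ l) \<le> 2 * norm (norm (E z) * norm (E z))"
  proof eventually_elim
    case (elim z)
    have "\<bar>(inv_sqrt (cov_at z) - mat 1 + (1/2) *\<^sub>R E z) $ k $ l\<bar> \<le> 2 * (norm (E z))\<^sup>2"
      unfolding E_def
      by (rule order_trans[OF matrix_entry_le_norm inv_sqrt_expansion[OF transpose_cov]])
        (use elim in \<open>simp add: E_def\<close>)
    then show ?case by (simp add: D_def power2_eq_square)
  qed
  then have "(\<lambda>z. D z $ k $ l + 1/2 * E z $ k $ l) \<in> O[F](\<lambda>z. norm (E z) * norm (E z))"
    by (rule bigoI)
  then have 1: "(\<lambda>z. D z $ k $ l + 1/2 * E z $ k $ l) \<in> O[F](rate)"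
    using bigo_rate_mult[OF nE nE] by (rule landau_o.big_trans)
  show ?thesis
    using sum_in_bigo(2)[OF 1 bigo_cmult[OF E_W_bigo, of "1/2" k l]] by (simp add: algebra_simps)
qed

lemma D_bigo: "(\<lambda>z. D z $ k $ l) \<in> O[F](root_rate)"
  using sum_in_bigo(2)[OF bigo_rate_imp_root[OF D_W_bigo] bigo_cmult[OF W_bigo], of k l "1/2" k l] by simp

text \<open>\<open>c\<close> is minus the mean minus \<open>D\<close> times the mean, and the last
  term is a product of two quantities of order \<open>root_rate\<close>.\<close>

lemma c_mean_bigo: "(\<lambda>z. c z $ k + sample_avg (\<lambda>x. x $ k) z) \<in> O[F](rate)"
proof -
  have "c z $ k + sample_avg (\<lambda>x. x $ k) z = - (\<Sum>l\<in>UNIV. D z $ k $ l * sample_avg (\<lambda>x. x $ l) z)" for z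
  proof -
    have "inv_sqrt (cov_at z) = mat 1 + D z" by (simp add: D_def)
    then have "c z = - mean_at z - D z *v mean_at z"
      by (simp add: c_def matrix_vector_mult_add_rdistrib)
    then show ?thesis by (simp add: matrix_vector_mult_def mean_nth)
  qed
  moreover have "(\<lambda>z. \<Sum>l\<in>UNIV. D z $ k $ l * sample_avg (\<lambda>x. x $ l) z) \<in> O[F](rate)"
    by (intro big_sum_in_bigo bigo_rate_mult D_bigo avg_nth)
  ultimately show ?thesis by simp
qed

lemma c_bigo: "(\<lambda>z. c z $ k) \<in> O[F](root_rate)"
  using sum_in_bigo(2)[OF bigo_rate_imp_root[OF c_mean_bigo] avg_nth, of k k] by simp

definition \<eta> :: "nat \<times> (nat \<Rightarrow> real^'p) \<Rightarrow> real" where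
  "\<eta> z = norm (D z) + norm (c z)"

lemma \<eta>_bigo: "\<eta> \<in> O[F](root_rate)"
  unfolding \<eta>_def[abs_def] by (intro sum_in_bigo norm_matrix_bigo norm_vec_bigo D_bigo c_bigo)

text \<open>Averaging a pointwise Taylor error gives \<open>(\<eta> z)\<^sup>2\<close> times the
  envelope average, hence order 1 / n. A pointwise bound for \<open>\<eta> z \<le> 1\<close>
  suffices because \<open>\<eta>\<close> tends to 0.\<close>

lemma remainder_bigo:
  assumes "\<And>z x. \<eta> z \<le> 1 \<Longrightarrow> \<bar>R z x\<bar> \<le> perturbation_const t * exp (envelope_exponent t * norm x) * (\<eta> z)\<^sup>2"
  shows "(\<lambda>z. sample_avg (R z) z) \<in> O[F](rate)"
proof -
  have "\<forall>\<^sub>F z in F. \<eta> z < 1"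
    by (rule order_tendstoD(2)[OF bigo_tendsto[OF \<eta>_bigo]]) simp
  then have "\<forall>\<^sub>F z in F. norm (sample_avg (R z) z)
      \<le> perturbation_const t * norm (\<eta> z * \<eta> z * sample_avg (\<lambda>x. exp (envelope_exponent t * norm x)) z)"
  proof eventually_elim
    case (elim z)
    have "\<bar>sample_avg (R z) z\<bar> \<le> sample_avg (\<lambda>x. perturbation_const t * exp (envelope_exponent t * norm x) * (\<eta> z)\<^sup>2) z"
      by (rule sample_avg_abs_le, rule assms) (use elim in simp)
    also have "\<dots> = perturbation_const t * (\<eta> z * \<eta> z * sample_avg (\<lambda>x. exp (envelope_exponent t * norm x)) z)"
      by (simp add: sample_avg_cmult sample_avg_multc power2_eq_square)
    also have "\<dots> \<le> perturbation_const t * norm (\<eta> z * \<eta> z * sample_avg (\<lambda>x. exp (envelope_exponent t * norm x)) z)"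
      by (intro mult_left_mono) (auto simp: perturbation_const_def)
    finally show ?case by simp
  qed
  then have "(\<lambda>z. sample_avg (R z) z) \<in> O[F](\<lambda>z. \<eta> z * \<eta> z * sample_avg (\<lambda>x. exp (envelope_exponent t * norm x)) z)"
    by (rule bigoI)
  also have "(\<lambda>z. \<eta> z * \<eta> z * sample_avg (\<lambda>x. exp (envelope_exponent t * norm x)) z) \<in> O[F](rate)"
    by (intro bigo_mult_1 bigo_rate_mult \<eta>_bigo avg_envelope)
  finally show ?thesis .
qed

text \<open>\<open>D\<close> and \<open>c\<close> do not depend on the observation, so they factor
  out of the average. Replacing the weighted averages by their means costs products of two small
  terms; replacing \<open>D\<close> by \<open>- 1/2 * W\<close> and \<open>c\<close> by minus the
  mean costs order 1 / n. What remains is the average of a fixed function of one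
  observation.\<close>

lemma weighted_shift:
  assumes w: "(\<lambda>z. sample_avg w z - \<mu>0) \<in> O[F](root_rate)"
    and wx: "\<And>j. (\<lambda>z. sample_avg (\<lambda>x. w x * x $ j) z - \<mu> j) \<in> O[F](root_rate)"
  shows "(\<lambda>z. sample_avg (\<lambda>x. w x * (D z *v x + c z) $ k) z - sample_avg (influence \<mu>0 \<mu> k) z) \<in> O[F](rate)"
proof -
  have 1: "sample_avg (\<lambda>x. w x * (D z *v x + c z) $ k) z
      = (\<Sum>j\<in>UNIV. D z $ k $ j * sample_avg (\<lambda>x. w x * x $ j) z) + c z $ k * sample_avg w z" for z
  proof -
    have "(\<lambda>x. w x * (D z *v x + c z) $ k) = (\<lambda>x. (\<Sum>j\<in>UNIV. D z $ k $ j * (w x * x $ j)) + c z $ k * w x)"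
      by (simp add: fun_eq_iff matrix_vector_mult_def distrib_left sum_distrib_left ac_simps)
    then show ?thesis by (simp add: sample_avg_add sample_avg_sum sample_avg_cmult)
  qed
  \<comment> \<open>The Kronecker deltas inside \<open>influence\<close> average to themselves only
    when the sample is nonempty.\<close>
  have 2: "sample_avg (influence \<mu>0 \<mu> k) z
      = (\<Sum>j\<in>UNIV. W k j z * (- (1/2) * \<mu> j)) - sample_avg (\<lambda>x. x $ k) z * \<mu>0" if "fst z > 0" for z
    unfolding influence_def[abs_def] W_def
    by (simp only: sample_avg_diff sample_avg_sum sample_avg_multc sample_avg_const[OF that])
  have "(\<lambda>z. (\<Sum>j\<in>UNIV. (D z $ k $ j * (sample_avg (\<lambda>x. w x * x $ j) z - \<mu> j))
      + (D z $ k $ j + 1/2 * W k j z) * \<mu> j)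
      + (c z $ k * (sample_avg w z - \<mu>0) + (c z $ k + sample_avg (\<lambda>x. x $ k) z) * \<mu>0)) \<in> O[F](rate)"
    by (intro sum_in_bigo big_sum_in_bigo bigo_rate_mult bigo_multc D_bigo D_W_bigo c_bigo c_mean_bigo w wx)
  moreover have "\<forall>\<^sub>F z in F. (\<Sum>j\<in>UNIV. (D z $ k $ j * (sample_avg (\<lambda>x. w x * x $ j) z - \<mu> j))
      + (D z $ k $ j + 1/2 * W k j z) * \<mu> j)
      + (c z $ k * (sample_avg w z - \<mu>0) + (c z $ k + sample_avg (\<lambda>x. x $ k) z) * \<mu>0)
      = sample_avg (\<lambda>x. w x * (D z *v x + c z) $ k) z - sample_avg (influence \<mu>0 \<mu> k) z"
    using eventually_pos
  proof eventually_elim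
    case (elim z)
    show ?case unfolding 1 2[OF elim]
      by (simp add: sum.distrib sum_subtractf sum_negf algebra_simps)
  qed
  ultimately show ?thesis using landau_o.big.in_cong by fast
qed

end

section \<open>The functions \<open>f0\<close>, \<open>f1\<close>, \<open>f2\<close> as first order
  influences\<close>

lemma matrix_partial_outer:
  "matrix_partial d (\<lambda>u. outer u u) t $ a $ b = (if a = d then t $ b else 0) + (if b = d then t $ a else 0)"
proof -
  have "((\<lambda>s. (t + s *\<^sub>R axis d 1) $ a * (t + s *\<^sub>R axis d 1) $ b) has_real_derivative
      (if a = d then t $ b else 0) + (if b = d then t $ a else 0)) (at 0)"
    by (auto intro!: derivative_eq_intros simp: axis_def)
  then show ?thesis
    by (simp add: matrix_partial_def outer_def DERIV_imp_deriv)
qed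

text \<open>All tilted moments carry the common factor \<open>m\<close>; once it is pulled out, the
  Kronecker delta leaves a single term \<open>r k\<close>.\<close>

lemma influence_affine:
  "influence (m * r0) (\<lambda>j. m * r j) k x
    = m * (- (1/2) * (x $ k * (\<Sum>j\<in>UNIV. x $ j * r j) - r k) - x $ k * r0)"
proof -
  have "(\<Sum>j\<in>UNIV. (x $ k * x $ j - (if k = j then 1 else 0)) * (- (1/2) * (m * r j)))
      = (\<Sum>j\<in>UNIV. - (1/2) * m * (x $ k * (x $ j * r j)) + (if k = j then 1/2 * m * r j else 0))"
    by (intro sum.cong) (auto simp: algebra_simps)
  also have "\<dots> = - (1/2) * m * (x $ k * (\<Sum>j\<in>UNIV. x $ j * r j)) + 1/2 * m * r k"
    by (simp only: sum.distrib sum_distrib_left[symmetric]) simp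
  finally show ?thesis by (simp add: influence_def algebra_simps)
qed

lemma sum_mult_inner:
  "(\<Sum>j\<in>UNIV. x $ j * ((if k = j then a else 0) + d * t $ j)) = a * x $ k + d * (t \<bullet> x)"
proof -
  have "x $ j * ((if k = j then a else 0) + d * t $ j) = (if k = j then a * x $ j else 0) + d * (t $ j * x $ j)" for j
    by (simp add: algebra_simps)
  then show ?thesis
    by (simp only: sum.distrib sum_distrib_left[symmetric]) (simp add: inner_vec_def)
qed

text \<open>This is (x x^T - I) t, the vector through which the covariance enters \<open>f0\<close>,
  \<open>f1\<close> and \<open>f2\<close>.\<close>

definition quad_dir :: "real^'p \<Rightarrow> real^'p \<Rightarrow> real^'p" where
  "quad_dir x t = (t \<bullet> x) *\<^sub>R x - t"

lemma inner_quad_dir: "t \<bullet> quad_dir x t = (t \<bullet> x)\<^sup>2 - (norm t)\<^sup>2"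
  by (simp add: quad_dir_def inner_diff_right power2_norm_eq_inner) (simp add: power2_eq_square)

lemma outer_mult_vec: "outer x y *v z = (y \<bullet> z) *\<^sub>R x"
  by (simp add: vec_eq_iff outer_def matrix_vector_mult_def inner_vec_def sum_distrib_left
      sum_distrib_right ac_simps)

lemma quad_dir_eq: "(outer x x - mat 1) *v t = quad_dir x t"
  by (simp add: matrix_vector_mult_diff_rdistrib outer_mult_vec quad_dir_def inner_commute)

lemma quad_dir_nth: "quad_dir x t $ k = (\<Sum>j\<in>UNIV. t $ j * (x $ k * x $ j - (if k = j then 1 else 0)))"
  unfolding quad_dir_eq[symmetric]
  by (simp add: matrix_vector_mult_def outer_def mat_def mult.commute)

lemma f0_eq_influence:
  "f0 x t = (\<Sum>i\<in>UNIV. t $ i * influence (exp ((norm t)\<^sup>2 / 2)) (\<lambda>j. t $ j * exp ((norm t)\<^sup>2 / 2)) i x)"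
proof -
  define m where "m = exp ((norm t)\<^sup>2 / 2)"
  have i: "influence m (\<lambda>j. t $ j * m) i x = m * (- (1/2) * quad_dir x t $ i - x $ i)" for i
    using influence_affine[of m 1 "\<lambda>j. t $ j" i x]
    by (simp add: quad_dir_def inner_vec_def ac_simps)
  have "(\<Sum>i\<in>UNIV. t $ i * influence m (\<lambda>j. t $ j * m) i x) = m * (- (1/2) * (t \<bullet> quad_dir x t) - t \<bullet> x)"
    unfolding i by (simp add: inner_vec_def sum_subtractf sum_negf sum_distrib_left algebra_simps)
  then show ?thesis
    unfolding inner_quad_dir by (simp add: f0_def m_def[symmetric] algebra_simps)
qed

text \<open>Product rule for exp(t . Z) Z_k: the sum comes from perturbing the exponential, under
  the weight exp(t . x) x_k, and the last term from perturbing the coordinate, under the weight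
  exp(t . x).\<close>

lemma f1_eq_influence:
  "f1 x t $ k = (\<Sum>i\<in>UNIV. t $ i * influence (t $ k * exp ((norm t)\<^sup>2 / 2))
        (\<lambda>j. ((if k = j then 1 else 0) + t $ k * t $ j) * exp ((norm t)\<^sup>2 / 2)) i x)
    + influence (exp ((norm t)\<^sup>2 / 2)) (\<lambda>j. t $ j * exp ((norm t)\<^sup>2 / 2)) k x"
proof -
  define m where "m = exp ((norm t)\<^sup>2 / 2)"
  have i: "influence m (\<lambda>j. t $ j * m) i x = m * (- (1/2) * quad_dir x t $ i - x $ i)" for i
    using influence_affine[of m 1 "\<lambda>j. t $ j" i x]
    by (simp add: quad_dir_def inner_vec_def ac_simps)
  have j: "influence (t $ k * m) (\<lambda>j. ((if k = j then 1 else 0) + t $ k * t $ j) * m) i x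
     = m * (- (1/2) * (x $ i * x $ k - (if k = i then 1 else 0) + t $ k * quad_dir x t $ i) - x $ i * t $ k)" for i
    using influence_affine[of m "t $ k" "\<lambda>j. (if k = j then 1 else 0) + t $ k * t $ j" i x]
    unfolding sum_mult_inner by (simp add: quad_dir_def algebra_simps)
  have "(\<Sum>i\<in>UNIV. t $ i * influence (t $ k * m) (\<lambda>j. ((if k = j then 1 else 0) + t $ k * t $ j) * m) i x)
      = (\<Sum>i\<in>UNIV. - (1/2) * m * (t $ i * (x $ k * x $ i - (if k = i then 1 else 0)))
          - (1/2) * m * t $ k * (t $ i * quad_dir x t $ i) - m * t $ k * (t $ i * x $ i))"
    unfolding j by (intro sum.cong) (auto simp: algebra_simps)
  also have "\<dots> = - (1/2) * m * quad_dir x t $ k - (1/2) * m * t $ k * (t \<bullet> quad_dir x t) - m * t $ k * (t \<bullet> x)"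
    unfolding quad_dir_nth[of x t k]
    by (simp only: inner_vec_def inner_real_def sum_subtractf sum_distrib_left)
  finally have s: "(\<Sum>i\<in>UNIV. t $ i * influence (t $ k * m) (\<lambda>j. ((if k = j then 1 else 0) + t $ k * t $ j) * m) i x)
    = - (1/2) * m * quad_dir x t $ k - (1/2) * m * t $ k * (t \<bullet> quad_dir x t) - m * t $ k * (t \<bullet> x)" .
  have "f1 x t $ k = m * (- (x $ k + (t \<bullet> x) * t $ k) - (1/2) * (2 * quad_dir x t $ k + (t \<bullet> quad_dir x t) * t $ k))"
    unfolding f1_def quad_dir_eq m_def
    by (simp add: matrix_vector_mult_add_rdistrib outer_mult_vec scaleR_matrix_vector_assoc[symmetric])
  then show ?thesis
    unfolding m_def[symmetric] s i by (simp add: algebra_simps)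
qed

text \<open>Product rule for exp(t . Z) Z_k Z_l. Perturbing the exponential brings in third tilted
  moments; each coordinate contributes a term whose weight contains the other coordinate.\<close>

lemma f2_eq_influence:
  fixes x t :: "real^'p"
  defines "m \<equiv> exp ((norm t)\<^sup>2 / 2)"
  shows "f2 x t $ k $ l = (\<Sum>i\<in>UNIV. t $ i * influence (((if k = l then 1 else 0) + t $ k * t $ l) * m)
        (\<lambda>j. ((if k = j then t $ l else 0) + (if l = j then t $ k else 0)
          + ((if k = l then 1 else 0) + t $ k * t $ l) * t $ j) * m) i x)
    + influence (t $ k * m) (\<lambda>j. ((if k = j then 1 else 0) + t $ k * t $ j) * m) l x
    + influence (t $ l * m) (\<lambda>j. ((if l = j then 1 else 0) + t $ l * t $ j) * m) k x"
proof -
  define \<kappa> where "\<kappa> = (if k = l then 1 else 0) + t $ k * t $ l"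
  let ?y = "quad_dir x t"
  have j: "influence (t $ k * m) (\<lambda>j. ((if k = j then 1 else 0) + t $ k * t $ j) * m) i x
     = m * (- (1/2) * (x $ i * x $ k - (if k = i then 1 else 0) + t $ k * ?y $ i) - x $ i * t $ k)" for i k
    using influence_affine[of m "t $ k" "\<lambda>j. (if k = j then 1 else 0) + t $ k * t $ j" i x]
    unfolding sum_mult_inner by (simp add: quad_dir_def algebra_simps)
  have s3: "(\<Sum>j\<in>UNIV. x $ j * ((if k = j then t $ l else 0) + (if l = j then t $ k else 0) + \<kappa> * t $ j))
      = t $ l * x $ k + t $ k * x $ l + \<kappa> * (t \<bullet> x)"
  proof -
    have "x $ j * ((if k = j then t $ l else 0) + (if l = j then t $ k else 0) + \<kappa> * t $ j)
        = (if k = j then t $ l * x $ j else 0) + (if l = j then t $ k * x $ j else 0) + \<kappa> * (t $ j * x $ j)" for j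
      by (simp add: algebra_simps)
    then show ?thesis
      by (simp only: sum.distrib sum_distrib_left[symmetric]) (simp add: inner_vec_def)
  qed
  have i: "influence (\<kappa> * m) (\<lambda>j. ((if k = j then t $ l else 0) + (if l = j then t $ k else 0) + \<kappa> * t $ j) * m) i x
      = - (1/2) * m * (t $ l * (x $ k * x $ i - (if k = i then 1 else 0)) + t $ k * (x $ l * x $ i - (if l = i then 1 else 0))
        + \<kappa> * ?y $ i) - m * \<kappa> * x $ i" for i
    using influence_affine[of m \<kappa> "\<lambda>j. (if k = j then t $ l else 0) + (if l = j then t $ k else 0) + \<kappa> * t $ j" i x]
    unfolding s3 by (simp add: quad_dir_def algebra_simps)
  have "(\<Sum>i\<in>UNIV. t $ i * influence (\<kappa> * m) (\<lambda>j. ((if k = j then t $ l else 0) + (if l = j then t $ k else 0) + \<kappa> * t $ j) * m) i x)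
      = (\<Sum>i\<in>UNIV. - (1/2) * m * t $ l * (t $ i * (x $ k * x $ i - (if k = i then 1 else 0)))
          - (1/2) * m * t $ k * (t $ i * (x $ l * x $ i - (if l = i then 1 else 0)))
          - (1/2) * m * \<kappa> * (t $ i * ?y $ i) - m * \<kappa> * (t $ i * x $ i))"
    unfolding i by (intro sum.cong refl) (simp add: algebra_simps)
  also have "\<dots> = - (1/2) * m * t $ l * ?y $ k - (1/2) * m * t $ k * ?y $ l
      - (1/2) * m * \<kappa> * (t \<bullet> ?y) - m * \<kappa> * (t \<bullet> x)"
    unfolding quad_dir_nth[of x t k] quad_dir_nth[of x t l]
    by (simp only: inner_vec_def inner_real_def sum_subtractf sum_distrib_left)
  finally have s: "(\<Sum>i\<in>UNIV. t $ i * influence (\<kappa> * m) (\<lambda>j. ((if k = j then t $ l else 0) + (if l = j then t $ k else 0) + \<kappa> * t $ j) * m) i x)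
    = - (1/2) * m * t $ l * ?y $ k - (1/2) * m * t $ k * ?y $ l - (1/2) * m * \<kappa> * (t \<bullet> ?y) - m * \<kappa> * (t \<bullet> x)" .
  \<comment> \<open>Summing over \<open>b\<close> produces \<open>quad_dir x t\<close>, so the
    derivative part is that of \<open>outer t t\<close> in this direction.\<close>
  have dd: "(\<Sum>a\<in>UNIV. \<Sum>b\<in>UNIV. (t $ b * (x $ a * x $ b - (if a = b then 1 else 0))) *
        (matrix_partial a (\<lambda>u. outer u u) t $ k $ l + t $ a * (t $ k * t $ l) + t $ a * (if k = l then 1 else 0)))
      = ?y $ k * t $ l + ?y $ l * t $ k + \<kappa> * (t \<bullet> ?y)"
  proof -
    have "(\<Sum>a\<in>UNIV. \<Sum>b\<in>UNIV. (t $ b * (x $ a * x $ b - (if a = b then 1 else 0))) *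
        (matrix_partial a (\<lambda>u. outer u u) t $ k $ l + t $ a * (t $ k * t $ l) + t $ a * (if k = l then 1 else 0)))
      = (\<Sum>a\<in>UNIV. ?y $ a * (matrix_partial a (\<lambda>u. outer u u) t $ k $ l + t $ a * (t $ k * t $ l) + t $ a * (if k = l then 1 else 0)))"
      by (simp only: sum_distrib_right[symmetric] quad_dir_nth)
    also have "\<dots> = (\<Sum>a\<in>UNIV. (if k = a then ?y $ a * t $ l else 0) + (if l = a then ?y $ a * t $ k else 0) + \<kappa> * (t $ a * ?y $ a))"
      unfolding matrix_partial_outer \<kappa>_def by (intro sum.cong refl) (simp add: algebra_simps)
    also have "\<dots> = ?y $ k * t $ l + ?y $ l * t $ k + \<kappa> * (t \<bullet> ?y)"
      by (simp add: sum.distrib inner_vec_def sum_distrib_left)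
    finally show ?thesis .
  qed
  have left: "((outer x x - mat 1) ** (mat 1 + outer t t)) $ k $ l
      = (x $ k * x $ l - (if k = l then 1 else 0)) + ?y $ k * t $ l"
  proof -
    have "((outer x x - mat 1) ** outer t t) $ k $ l = ((outer x x - mat 1) *v t) $ k * t $ l"
      by (simp add: matrix_matrix_mult_def matrix_vector_mult_def outer_def sum_distrib_left sum_distrib_right ac_simps)
    then show ?thesis
      unfolding quad_dir_eq by (simp add: matrix_add_ldistrib) (simp add: outer_def mat_def)
  qed
  have right: "((mat 1 + outer t t) ** (outer x x - mat 1)) $ k $ l
      = (x $ k * x $ l - (if k = l then 1 else 0)) + t $ k * ?y $ l"
  proof -
    have "(outer x x - mat 1) $ j $ l = (outer x x - mat 1) $ l $ j" for j
      by (simp add: outer_def mat_def)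
    then have "(outer t t ** (outer x x - mat 1)) $ k $ l = t $ k * ((outer x x - mat 1) *v t) $ l"
      by (simp add: matrix_matrix_mult_def matrix_vector_mult_def outer_def[of t t] sum_distrib_left ac_simps)
    then show ?thesis
      unfolding quad_dir_eq by (simp add: matrix_add_rdistrib) (simp add: outer_def mat_def)
  qed
  have "f2 x t $ k $ l = m * (- (1/2) * ((x $ k * x $ l - (if k = l then 1 else 0)) + ?y $ k * t $ l)
      - x $ k * t $ l - (1/2) * ((x $ k * x $ l - (if k = l then 1 else 0)) + t $ k * ?y $ l)
      - t $ k * x $ l - (1/2) * (?y $ k * t $ l + ?y $ l * t $ k + \<kappa> * (t \<bullet> ?y)) - (t \<bullet> x) * \<kappa>)"
    unfolding f2_def m_def dd[symmetric] left[symmetric] right[symmetric]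
    by (simp add: outer_def mat_def \<kappa>_def sum_component)
  then show ?thesis
    unfolding \<kappa>_def[symmetric] s j by (simp add: algebra_simps)
qed

section \<open>Linearisation of the Hessian of the empirical cumulant generating function\<close>

context regular_samples
begin

definition m :: real where "m = exp ((norm t)\<^sup>2 / 2)"

lemma m_pos: "m > 0" by (simp add: m_def)

definition M :: "nat \<times> (nat \<Rightarrow> real^'p) \<Rightarrow> real" where
  "M z = emp_mgf (fst z) (snd z) t"

definition G :: "'p \<Rightarrow> nat \<times> (nat \<Rightarrow> real^'p) \<Rightarrow> real" where
  "G k z = grad_emp_mgf (fst z) (snd z) t $ k"

definition H :: "'p \<Rightarrow> 'p \<Rightarrow> nat \<times> (nat \<Rightarrow> real^'p) \<Rightarrow> real" where
  "H k l z = hess_emp_mgf (fst z) (snd z) t $ k $ l"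

lemma M_eq: "M z = sample_avg (\<lambda>x. exp (t \<bullet> (x + (D z *v x + c z)))) z"
  by (simp add: M_def emp_mgf_def sample_avg_def scaled_residual_eq)

lemma G_eq: "G k z = sample_avg (\<lambda>x. exp (t \<bullet> (x + (D z *v x + c z))) * (x + (D z *v x + c z)) $ k) z"
  by (simp add: G_def grad_emp_mgf_def sample_avg_def scaled_residual_eq)

lemma H_eq: "H k l z = sample_avg (\<lambda>x. exp (t \<bullet> (x + (D z *v x + c z))) * (x + (D z *v x + c z)) $ k
    * (x + (D z *v x + c z)) $ l) z"
  by (simp add: H_def hess_emp_mgf_def sample_avg_def scaled_residual_eq outer_def ac_simps)

lemma weighted_inner_shift:
  assumes w: "(\<lambda>z. sample_avg w z - \<mu>0) \<in> O[F](root_rate)"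
    and wx: "\<And>j. (\<lambda>z. sample_avg (\<lambda>x. w x * x $ j) z - \<mu> j) \<in> O[F](root_rate)"
  shows "(\<lambda>z. sample_avg (\<lambda>x. w x * (t \<bullet> (D z *v x + c z))) z
      - sample_avg (\<lambda>x. \<Sum>i\<in>UNIV. t $ i * influence \<mu>0 \<mu> i x) z) \<in> O[F](rate)"
proof -
  have "(\<lambda>x. w x * (t \<bullet> (D z *v x + c z))) = (\<lambda>x. \<Sum>i\<in>UNIV. t $ i * (w x * (D z *v x + c z) $ i))" for z
    by (simp add: fun_eq_iff inner_vec_def sum_distrib_left ac_simps)
  then have "(\<lambda>z. sample_avg (\<lambda>x. w x * (t \<bullet> (D z *v x + c z))) z
        - sample_avg (\<lambda>x. \<Sum>i\<in>UNIV. t $ i * influence \<mu>0 \<mu> i x) z)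
      = (\<lambda>z. \<Sum>i\<in>UNIV. t $ i * (sample_avg (\<lambda>x. w x * (D z *v x + c z) $ i) z - sample_avg (influence \<mu>0 \<mu> i) z))"
    by (simp only: sample_avg_sum sample_avg_cmult sum_subtractf[symmetric] right_diff_distrib)
  also have "\<dots> \<in> O[F](rate)"
    by (intro big_sum_in_bigo bigo_cmult weighted_shift w wx)
  finally show ?thesis .
qed

lemmas avgs = avg_exp avg_exp_nth avg_exp_nth2 avg_exp_nth3

lemma sample_avg_expansion:
  assumes "(\<lambda>z. sample_avg (\<lambda>x. P z x - P0 x - P1 z x) z) \<in> O[F](rate)"
    and "(\<lambda>z. sample_avg (P1 z) z - sample_avg Q z) \<in> O[F](rate)"
  shows "(\<lambda>z. sample_avg (P z) z - sample_avg P0 z - sample_avg Q z) \<in> O[F](rate)"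
  using sum_in_bigo(1)[OF assms] by (simp only: sample_avg_diff) (simp add: algebra_simps)

lemma M_expansion: "(\<lambda>z. M z - sample_avg (\<lambda>x. exp (t \<bullet> x)) z - sample_avg (\<lambda>x. f0 x t) z) \<in> O[F](rate)"
  unfolding M_eq
proof (rule sample_avg_expansion)
  show "(\<lambda>z. sample_avg (\<lambda>x. exp (t \<bullet> (x + (D z *v x + c z))) - exp (t \<bullet> x) - exp (t \<bullet> x) * (t \<bullet> (D z *v x + c z))) z)
      \<in> O[F](rate)"
    by (rule remainder_bigo, rule perturb_exp) (auto simp: \<eta>_def)
  show "(\<lambda>z. sample_avg (\<lambda>x. exp (t \<bullet> x) * (t \<bullet> (D z *v x + c z))) z - sample_avg (\<lambda>x. f0 x t) z) \<in> O[F](rate)"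
    unfolding f0_eq_influence by (intro weighted_inner_shift avgs)
qed

lemma G_expansion:
  "(\<lambda>z. G k z - sample_avg (\<lambda>x. exp (t \<bullet> x) * x $ k) z - sample_avg (\<lambda>x. f1 x t $ k) z) \<in> O[F](rate)"
  unfolding G_eq
proof (rule sample_avg_expansion)
  show "(\<lambda>z. sample_avg (\<lambda>x. exp (t \<bullet> (x + (D z *v x + c z))) * (x + (D z *v x + c z)) $ k - exp (t \<bullet> x) * x $ k
     - (exp (t \<bullet> x) * (D z *v x + c z) $ k + exp (t \<bullet> x) * (t \<bullet> (D z *v x + c z)) * x $ k)) z) \<in> O[F](rate)"
    by (rule remainder_bigo, rule perturb_exp_nth) (auto simp: \<eta>_def)
  \<comment> \<open>The product rule terms are regrouped as a weight times the shift or its inner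
    product with \<open>t\<close>, the two forms covered by \<open>weighted_shift\<close> and
    \<open>weighted_inner_shift\<close>.\<close>
  have eq: "(\<lambda>x. exp (t \<bullet> x) * (D z *v x + c z) $ k + exp (t \<bullet> x) * (t \<bullet> (D z *v x + c z)) * x $ k)
      = (\<lambda>x. exp (t \<bullet> x) * x $ k * (t \<bullet> (D z *v x + c z)) + exp (t \<bullet> x) * (D z *v x + c z) $ k)" for z
    by (simp add: fun_eq_iff mult_ac add.commute)
  show "(\<lambda>z. sample_avg (\<lambda>x. exp (t \<bullet> x) * (D z *v x + c z) $ k + exp (t \<bullet> x) * (t \<bullet> (D z *v x + c z)) * x $ k) z
      - sample_avg (\<lambda>x. f1 x t $ k) z) \<in> O[F](rate)"
    unfolding eq f1_eq_influence sample_avg_add add_diff_add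
    by (intro sum_in_bigo weighted_inner_shift weighted_shift avgs)
qed

lemma H_expansion:
  "(\<lambda>z. H k l z - sample_avg (\<lambda>x. exp (t \<bullet> x) * x $ k * x $ l) z - sample_avg (\<lambda>x. f2 x t $ k $ l) z) \<in> O[F](rate)"
  unfolding H_eq
proof (rule sample_avg_expansion)
  show "(\<lambda>z. sample_avg (\<lambda>x. exp (t \<bullet> (x + (D z *v x + c z))) * (x + (D z *v x + c z)) $ k * (x + (D z *v x + c z)) $ l
       - exp (t \<bullet> x) * x $ k * x $ l
     - (exp (t \<bullet> x) * x $ k * (D z *v x + c z) $ l
       + (exp (t \<bullet> x) * (D z *v x + c z) $ k + exp (t \<bullet> x) * (t \<bullet> (D z *v x + c z)) * x $ k) * x $ l)) z) \<in> O[F](rate)"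
    by (rule remainder_bigo, rule perturb_exp_nth_nth) (auto simp: \<eta>_def)
  have eq: "(\<lambda>x. exp (t \<bullet> x) * x $ k * (D z *v x + c z) $ l
       + (exp (t \<bullet> x) * (D z *v x + c z) $ k + exp (t \<bullet> x) * (t \<bullet> (D z *v x + c z)) * x $ k) * x $ l)
    = (\<lambda>x. exp (t \<bullet> x) * x $ k * x $ l * (t \<bullet> (D z *v x + c z)) + exp (t \<bullet> x) * x $ k * (D z *v x + c z) $ l
       + exp (t \<bullet> x) * x $ l * (D z *v x + c z) $ k)" for z
    by (simp add: fun_eq_iff algebra_simps)
  show "(\<lambda>z. sample_avg (\<lambda>x. exp (t \<bullet> x) * x $ k * (D z *v x + c z) $ l
       + (exp (t \<bullet> x) * (D z *v x + c z) $ k + exp (t \<bullet> x) * (t \<bullet> (D z *v x + c z)) * x $ k) * x $ l) z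
      - sample_avg (\<lambda>x. f2 x t $ k $ l) z) \<in> O[F](rate)"
    unfolding eq f2_eq_influence sample_avg_add add_diff_add
    by (intro sum_in_bigo weighted_inner_shift weighted_shift avgs)
qed

lemma influence_bigo: "(\<lambda>z. sample_avg (influence \<mu>0 \<mu> k) z) \<in> O[F](root_rate)"
proof -
  have "(\<lambda>z. (\<Sum>j\<in>UNIV. W k j z * (- (1/2) * \<mu> j)) - sample_avg (\<lambda>x. x $ k) z * \<mu>0) \<in> O[F](root_rate)"
    by (intro sum_in_bigo big_sum_in_bigo bigo_multc W_bigo avg_nth)
  moreover have "\<forall>\<^sub>F z in F. (\<Sum>j\<in>UNIV. W k j z * (- (1/2) * \<mu> j)) - sample_avg (\<lambda>x. x $ k) z * \<mu>0
      = sample_avg (influence \<mu>0 \<mu> k) z"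
    using eventually_pos
  proof eventually_elim
    case (elim z)
    show ?case
      unfolding influence_def[abs_def] W_def
      by (simp only: sample_avg_diff sample_avg_sum sample_avg_multc sample_avg_const[OF elim])
  qed
  ultimately show ?thesis using landau_o.big.in_cong by fast
qed

lemma avg_f0_bigo: "(\<lambda>z. sample_avg (\<lambda>x. f0 x t) z) \<in> O[F](root_rate)"
  unfolding f0_eq_influence sample_avg_sum sample_avg_cmult
  by (intro big_sum_in_bigo bigo_cmult influence_bigo)

lemma avg_f1_bigo: "(\<lambda>z. sample_avg (\<lambda>x. f1 x t $ k) z) \<in> O[F](root_rate)"
  unfolding f1_eq_influence sample_avg_sum sample_avg_cmult sample_avg_add
  by (intro sum_in_bigo big_sum_in_bigo bigo_cmult influence_bigo)

lemma avg_f2_bigo: "(\<lambda>z. sample_avg (\<lambda>x. f2 x t $ k $ l) z) \<in> O[F](root_rate)"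
  unfolding f2_eq_influence sample_avg_sum sample_avg_cmult sample_avg_add
  by (intro sum_in_bigo big_sum_in_bigo bigo_cmult influence_bigo)

lemma M_bigo: "(\<lambda>z. M z - m) \<in> O[F](root_rate)"
  using sum_in_bigo(1)[OF sum_in_bigo(1)[OF bigo_rate_imp_root[OF M_expansion] avg_exp] avg_f0_bigo]
  by (simp add: m_def)

lemma G_bigo: "(\<lambda>z. G k z - t $ k * m) \<in> O[F](root_rate)"
  using sum_in_bigo(1)[OF sum_in_bigo(1)[OF bigo_rate_imp_root[OF G_expansion] avg_exp_nth] avg_f1_bigo, of k k k]
  by (simp add: m_def)

lemma H_bigo: "(\<lambda>z. H k l z - ((if k = l then 1 else 0) + t $ k * t $ l) * m) \<in> O[F](root_rate)"
  using sum_in_bigo(1)[OF sum_in_bigo(1)[OF bigo_rate_imp_root[OF H_expansion] avg_exp_nth2] avg_f2_bigo, of k l k l k l]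
  by (simp add: m_def)

text \<open>Where M is nonzero, this is M^2 times an entry of \<open>hess_emp_cgf - mat 1\<close>.
  Subtracting the identity before dividing leaves a polynomial in M, G and H with limit 0.\<close>

definition numerator :: "'p \<Rightarrow> 'p \<Rightarrow> nat \<times> (nat \<Rightarrow> real^'p) \<Rightarrow> real" where
  "numerator k l z = M z * H k l z - G k z * G l z - (if k = l then 1 else 0) * (M z)\<^sup>2"

lemma numerator_expansion:
  "(\<lambda>z. numerator k l z - sample_avg (\<lambda>x. (g1 x t + g2 x t) $ k $ l) z) \<in> O[F](rate)"
proof -
  let ?d = "(if k = l then 1 else 0) :: real"
  let ?\<kappa> = "?d + t $ k * t $ l"
  define a where "a z = sample_avg (\<lambda>x. exp (t \<bullet> x)) z" for z
  define ak where "ak k z = sample_avg (\<lambda>x. exp (t \<bullet> x) * x $ k) z" for k z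
  define akl where "akl z = sample_avg (\<lambda>x. exp (t \<bullet> x) * x $ k * x $ l) z" for z
  define b where "b z = sample_avg (\<lambda>x. f0 x t) z" for z
  define bk where "bk k z = sample_avg (\<lambda>x. f1 x t $ k) z" for k z
  define bkl where "bkl z = sample_avg (\<lambda>x. f2 x t $ k $ l) z" for z
  have "g1 x t $ k $ l + g2 x t $ k $ l
      = m * (exp (t \<bullet> x) * x $ k * x $ l + (t $ k * t $ l - ?d) * exp (t \<bullet> x)
          - t $ k * (exp (t \<bullet> x) * x $ l) - t $ l * (exp (t \<bullet> x) * x $ k))
        + m * (f2 x t $ k $ l + (t $ k * t $ l - ?d) * f0 x t - t $ k * f1 x t $ l - t $ l * f1 x t $ k)" for x
    by (simp add: g1_def g2_def m_def outer_def mat_def algebra_simps)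
  then have lin: "sample_avg (\<lambda>x. (g1 x t + g2 x t) $ k $ l) z
      = m * (akl z + (t $ k * t $ l - ?d) * a z - t $ k * ak l z - t $ l * ak k z)
       + m * (bkl z + (t $ k * t $ l - ?d) * b z - t $ k * bk l z - t $ l * bk k z)" for z
    unfolding vector_add_component
    by (simp only: sample_avg_add sample_avg_diff sample_avg_cmult a_def ak_def akl_def b_def bk_def bkl_def)
  \<comment> \<open>A quadratic polynomial equals its second order expansion at the limit point (m,
    t m, \<open>?\<kappa> * m\<close>), where its value is 0. The coefficient of M is m
    (\<open>?\<kappa> - 2 * ?d\<close>) = m (\<open>t $ k * t $ l - ?d\<close>), and the last three
    terms are products of deviations.\<close>
  have alg: "numerator k l z - sample_avg (\<lambda>x. (g1 x t + g2 x t) $ k $ l) z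
     = m * (H k l z - akl z - bkl z) + m * ((t $ k * t $ l - ?d) * (M z - a z - b z))
       - m * (t $ k * (G l z - ak l z - bk l z)) - m * (t $ l * (G k z - ak k z - bk k z))
       + (M z - m) * (H k l z - ?\<kappa> * m) - (G k z - t $ k * m) * (G l z - t $ l * m)
       - ?d * ((M z - m) * (M z - m))" for z
    unfolding numerator_def lin by (simp add: algebra_simps power2_eq_square)
  show ?thesis
    unfolding alg a_def ak_def akl_def b_def bk_def bkl_def
    by (intro sum_in_bigo bigo_cmult bigo_rate_mult M_expansion G_expansion H_expansion M_bigo G_bigo H_bigo)
qed

text \<open>Serves to replace 1 / M^2 by 1 / m^2: the cost is the numerator times
  \<open>M - m\<close>, so both factors have to be small.\<close>

lemma numerator_bigo: "numerator k l \<in> O[F](root_rate)"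
proof -
  let ?d = "(if k = l then 1 else 0) :: real"
  have eq: "numerator k l = (\<lambda>z. m * (H k l z - (?d + t $ k * t $ l) * m) + H k l z * (M z - m)
      - G l z * (G k z - t $ k * m) - m * t $ k * (G l z - t $ l * m) - ?d * (m * (M z - m)) - ?d * (M z * (M z - m)))"
    by (simp add: fun_eq_iff numerator_def power2_eq_square algebra_simps)
  have one: "(\<lambda>z. M z) \<in> O[F](\<lambda>_. 1)" "(\<lambda>z. G l z) \<in> O[F](\<lambda>_. 1)" "(\<lambda>z. H k l z) \<in> O[F](\<lambda>_. 1)"
    using sum_in_bigo(1)[OF bigo_root_rate_imp_1[OF M_bigo], of "\<lambda>_. m"]
      sum_in_bigo(1)[OF bigo_root_rate_imp_1[OF G_bigo], of "\<lambda>_. t $ l * m" l]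
      sum_in_bigo(1)[OF bigo_root_rate_imp_1[OF H_bigo], of "\<lambda>_. ((if k = l then 1 else 0) + t $ k * t $ l) * m" k l]
    by simp_all
  show ?thesis
    unfolding eq by (intro sum_in_bigo bigo_cmult bigo_1_mult one M_bigo G_bigo H_bigo)
qed

lemma M_ge: "\<forall>\<^sub>F z in F. m / 2 < M z"
proof -
  have "\<forall>\<^sub>F z in F. - (m / 2) < M z - m"
    by (rule order_tendstoD(1)[OF bigo_tendsto[OF M_bigo]]) (use m_pos in simp)
  then show ?thesis by eventually_elim simp
qed

lemma hess_emp_cgf_expansion:
  "(\<lambda>z. (hess_emp_cgf (fst z) (snd z) t - mat 1) $ k $ l - sample_avg (\<lambda>x. h x t $ k $ l) z) \<in> O[F](rate)"
proof -
  have h: "h x t $ k $ l = (g1 x t + g2 x t) $ k $ l * (1 / m\<^sup>2)" for x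
    by (simp add: h_def m_def exp_minus power2_eq_square mult_exp_exp field_simps)
  have inv1: "(\<lambda>z. 1 / (M z)\<^sup>2) \<in> O[F](\<lambda>_. 1)"
  proof (rule bigoI[of _ "1 / (m / 2)\<^sup>2"])
    show "\<forall>\<^sub>F z in F. norm (1 / (M z)\<^sup>2) \<le> 1 / (m / 2)\<^sup>2 * norm (1 :: real)"
      using M_ge
    proof eventually_elim
      case (elim z)
      then have "(m / 2)\<^sup>2 \<le> (M z)\<^sup>2" using m_pos by (intro power_mono) auto
      then show ?case using m_pos by (simp add: frac_le)
    qed
  qed
  have M1: "M \<in> O[F](\<lambda>_. 1)"
    using sum_in_bigo(1)[OF bigo_root_rate_imp_1[OF M_bigo], of "\<lambda>_. m"] by simp
  \<comment> \<open>For numerator N and linear part A, N / M^2 - A / m^2 = N (1 / M^2 - 1 / m^2) +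
    (N - A) / m^2, and the first bracket is - (M - m) (M + m) / (m^2 M^2).\<close>
  have "(\<lambda>z. numerator k l z * (M z - m) * ((- (1 / m\<^sup>2)) * ((M z + m) * (1 / (M z)\<^sup>2)))
      + (numerator k l z - sample_avg (\<lambda>x. (g1 x t + g2 x t) $ k $ l) z) * (1 / m\<^sup>2)) \<in> O[F](rate)"
    by (intro sum_in_bigo bigo_mult_1[where r = rate] bigo_rate_mult bigo_multc bigo_cmult[where r = "\<lambda>_. 1"]
        bigo_mult_1[where r = "\<lambda>_. 1"] numerator_bigo M_bigo numerator_expansion inv1 M1) simp_all
  moreover have "\<forall>\<^sub>F z in F. numerator k l z * (M z - m) * ((- (1 / m\<^sup>2)) * ((M z + m) * (1 / (M z)\<^sup>2)))
      + (numerator k l z - sample_avg (\<lambda>x. (g1 x t + g2 x t) $ k $ l) z) * (1 / m\<^sup>2)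
      = (hess_emp_cgf (fst z) (snd z) t - mat 1) $ k $ l - sample_avg (\<lambda>x. h x t $ k $ l) z"
    using M_ge
  proof eventually_elim
    case (elim z)
    then have Mz: "M z \<noteq> 0" using m_pos by auto
    have "hess_emp_cgf (fst z) (snd z) t $ k $ l = (M z * H k l z - G k z * G l z) / (M z)\<^sup>2"
      by (simp add: hess_emp_cgf_def M_def H_def G_def outer_def)
    then have 1: "(hess_emp_cgf (fst z) (snd z) t - mat 1) $ k $ l = numerator k l z / (M z)\<^sup>2"
      using Mz by (simp add: numerator_def mat_def diff_divide_distrib)
    show ?case
      unfolding 1 h sample_avg_multc using Mz m_pos
      by (simp add: field_simps power2_eq_square)
  qed
  ultimately show ?thesis using landau_o.big.in_cong by fast
qed

lemma hess_emp_cgf_remainder_tendsto: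
  "((\<lambda>z. (sqrt (real (fst z)) *\<^sub>R (hess_emp_cgf (fst z) (snd z) t - mat 1)
      - (1 / sqrt (real (fst z))) *\<^sub>R (\<Sum>i<fst z. h (snd z i) t)) $ k $ l) \<longlongrightarrow> 0) F"
proof (rule bigo_tendsto)
  let ?R = "\<lambda>z. (hess_emp_cgf (fst z) (snd z) t - mat 1) $ k $ l - sample_avg (\<lambda>x. h x t $ k $ l) z"
  have "(\<lambda>z. sqrt (real (fst z)) * ?R z) \<in> O[F](\<lambda>z. sqrt (real (fst z)) * rate z)"
    by (intro landau_o.big.mult hess_emp_cgf_expansion) simp
  also have "(\<lambda>z. sqrt (real (fst z)) * rate z) = root_rate"
    by (simp add: fun_eq_iff sqrt_divide_self_eq inverse_eq_divide)
  finally have "(\<lambda>z. sqrt (real (fst z)) * ?R z) \<in> O[F](root_rate)" .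
  moreover have "sqrt (real (fst z)) * ?R z = (sqrt (real (fst z)) *\<^sub>R (hess_emp_cgf (fst z) (snd z) t - mat 1)
      - (1 / sqrt (real (fst z))) *\<^sub>R (\<Sum>i<fst z. h (snd z i) t)) $ k $ l" for z
  proof -
    have "sqrt (real (fst z)) * (s / real (fst z)) = s / sqrt (real (fst z))" for s
      by (cases "fst z = 0") (simp_all add: real_div_sqrt field_simps)
    then show ?thesis
      by (simp add: sample_avg_def right_diff_distrib sum_component)
  qed
  ultimately show "(\<lambda>z. (sqrt (real (fst z)) *\<^sub>R (hess_emp_cgf (fst z) (snd z) t - mat 1)
      - (1 / sqrt (real (fst z))) *\<^sub>R (\<Sum>i<fst z. h (snd z i) t)) $ k $ l) \<in> O[F](root_rate)"
    by simp
qed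

end

subsection \<open>From uniform bounds to convergence in probability\<close>

text \<open>Variances add: the new summand is independent of the partial sum and has mean zero, so
  the cross term vanishes.\<close>

lemma (in prob_space) sum_iid_second_moment:
  fixes Z :: "nat \<Rightarrow> 'a \<Rightarrow> real"
  assumes indep: "indep_vars (\<lambda>_. borel) Z UNIV"
    and int: "\<And>i. integrable M (Z i)" "\<And>i. integrable M (\<lambda>\<omega>. (Z i \<omega>)\<^sup>2)"
    and zero: "\<And>i. expectation (Z i) = 0" and var: "\<And>i. expectation (\<lambda>\<omega>. (Z i \<omega>)\<^sup>2) = v"
  shows "integrable M (\<lambda>\<omega>. (\<Sum>i<n. Z i \<omega>)\<^sup>2) \<and> expectation (\<lambda>\<omega>. (\<Sum>i<n. Z i \<omega>)\<^sup>2) = real n * v"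
proof (induction n)
  case (Suc n)
  define S where "S \<omega> = (\<Sum>i<n. Z i \<omega>)" for \<omega>
  have iS: "integrable M S" unfolding S_def by (intro Bochner_Integration.integrable_sum int)
  have "indep_var borel (Z n) borel S"
    unfolding S_def by (rule indep_vars_sum) (auto intro: indep_vars_subset[OF indep])
  note prod = indep_var_integrable[OF this int(1) iS] indep_var_lebesgue_integral[OF this int(1) iS]
  have eq: "(\<Sum>i<Suc n. Z i \<omega>)\<^sup>2 = (S \<omega>)\<^sup>2 + 2 * (Z n \<omega> * S \<omega>) + (Z n \<omega>)\<^sup>2" for \<omega>
    by (simp add: S_def power2_sum)
  have IH: "integrable M (\<lambda>\<omega>. (S \<omega>)\<^sup>2)" "expectation (\<lambda>\<omega>. (S \<omega>)\<^sup>2) = real n * v"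
    using Suc by (auto simp: S_def)
  show ?case
    unfolding eq using IH int(2)[of n] prod var[of n] zero[of n] by (simp add: distrib_right)
qed simp

locale iid_std_mvn = prob_space +
  fixes X :: "nat \<Rightarrow> 'a \<Rightarrow> real^'p"
  assumes indep: "indep_vars (\<lambda>_. borel) X UNIV"
    and distr: "\<And>i. distributed M lborel (X i) std_mvn_density"
begin

lemma std_mvn_X: "std_mvn M (X i)"
  by unfold_locales (rule distr)

lemma X_measurable [measurable]: "X i \<in> borel_measurable M"
  using distr[of i] by (simp add: distributed_def)

lemma expectation_X_eq:
  assumes [measurable]: "f \<in> borel_measurable borel"
  shows "expectation (\<lambda>\<omega>. f (X i \<omega>)) = expectation (\<lambda>\<omega>. f (X j \<omega>) :: real)"
proof -
  have "expectation (\<lambda>\<omega>. f (X i \<omega>)) = (\<integral>x. std_mvn_density x * f x \<partial>lborel)" for i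
    by (rule distributed_integral[OF distr, symmetric]) (auto simp: std_mvn_density_def)
  then show ?thesis by simp
qed

definition \<mu> :: "(real^'p \<Rightarrow> real) \<Rightarrow> real" where
  "\<mu> f = expectation (\<lambda>\<omega>. f (X 0 \<omega>))"

definition deviation :: "(real^'p \<Rightarrow> real) \<Rightarrow> nat \<Rightarrow> 'a \<Rightarrow> real" where
  "deviation f n \<omega> = \<bar>sample_avg f (n, \<lambda>i. X i \<omega>) - \<mu> f\<bar>"

lemma deviation_measurable:
  assumes [measurable]: "f \<in> borel_measurable borel"
  shows "deviation f n \<in> borel_measurable M"
  unfolding deviation_def[abs_def] sample_avg_def fst_conv snd_conv by measurable

text \<open>The average has variance V / n, which Chebyshev compares with the square of K / sqrt n;
  the sample size cancels, so the bound is uniform in n.\<close>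

lemma deviation_prob_le:
  assumes f: "exp_growth f"
  obtains V where "0 \<le> V" "\<And>n K. n > 0 \<Longrightarrow> K > 0 \<Longrightarrow>
    prob {\<omega> \<in> space M. deviation f n \<omega> \<ge> K / sqrt (real n)} \<le> V / K\<^sup>2"
proof -
  note [measurable] = exp_growth_measurable[OF f]
  define Z where "Z i \<omega> = f (X i \<omega>) - \<mu> f" for i \<omega>
  define V where "V = expectation (\<lambda>\<omega>. (Z 0 \<omega>)\<^sup>2)"
  have g: "exp_growth (\<lambda>x. f x - \<mu> f)"
    using exp_growth_add[OF f exp_growth_const[of "- \<mu> f"]] by simp
  have int: "integrable M (\<lambda>\<omega>. f (X i \<omega>))" "integrable M (Z i)" "integrable M (\<lambda>\<omega>. (Z i \<omega>)\<^sup>2)" for i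
    using std_mvn.integrable_exp_growth[OF std_mvn_X f] std_mvn.integrable_exp_growth[OF std_mvn_X g]
      std_mvn.integrable_exp_growth[OF std_mvn_X exp_growth_power[OF g, of 2]]
    by (auto simp: Z_def[abs_def])
  have zero: "expectation (Z i) = 0" for i
    unfolding Z_def using int(1)[of i] expectation_X_eq[of f i 0] by (simp add: \<mu>_def prob_space)
  have var: "expectation (\<lambda>\<omega>. (Z i \<omega>)\<^sup>2) = V" for i
    unfolding V_def Z_def by (rule expectation_X_eq) measurable
  have ind: "indep_vars (\<lambda>_. borel) Z UNIV"
    unfolding Z_def[abs_def] by (rule indep_vars_compose2[OF indep, of "\<lambda>_ x. f x - \<mu> f"]) measurable
  note mom = sum_iid_second_moment[OF ind int(2,3) zero var]
  have [measurable]: "Z i \<in> borel_measurable M" for i using int(2) by auto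
  have bound: "prob {\<omega> \<in> space M. deviation f n \<omega> \<ge> K / sqrt (real n)} \<le> V / K\<^sup>2" if n: "n > 0" and K: "K > 0" for n K
  proof -
    define S where "S \<omega> = (\<Sum>i<n. Z i \<omega>)" for \<omega>
    have S: "expectation S = 0" "integrable M (\<lambda>\<omega>. (S \<omega>)\<^sup>2)" "expectation (\<lambda>\<omega>. (S \<omega>)\<^sup>2) = real n * V"
      unfolding S_def using mom[of n] zero int(2) by simp_all
    have "deviation f n \<omega> = \<bar>S \<omega>\<bar> / real n" for \<omega>
    proof -
      have "S \<omega> = (\<Sum>i<n. f (X i \<omega>)) - real n * \<mu> f"
        by (simp add: S_def Z_def sum_subtractf)
      then have "S \<omega> / real n = sample_avg f (n, \<lambda>i. X i \<omega>) - \<mu> f"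
        using n by (simp add: sample_avg_def diff_divide_distrib)
      then show ?thesis unfolding deviation_def by (simp flip: \<open>S \<omega> / real n = _\<close> add: abs_divide)
    qed
    moreover have "K / sqrt (real n) * real n = K * sqrt (real n)"
      using n real_div_sqrt[of "real n"] by (metis of_nat_0_le_iff times_divide_eq_left times_divide_eq_right)
    ultimately have "{\<omega> \<in> space M. deviation f n \<omega> \<ge> K / sqrt (real n)}
        = {\<omega> \<in> space M. \<bar>S \<omega> - expectation S\<bar> \<ge> K * sqrt (real n)}"
      using n by (simp add: S pos_le_divide_eq)
    also have "prob \<dots> \<le> variance S / (K * sqrt (real n))\<^sup>2"
      by (rule Chebyshev_inequality) (use S n K in \<open>auto simp: S_def[abs_def]\<close>)
    also have "\<dots> = V / K\<^sup>2" using n by (simp add: S power_mult_distrib)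
    finally show ?thesis .
  qed
  show ?thesis by (rule that[of V]) (use bound in \<open>auto simp: V_def\<close>)
qed

definition bounded_samples :: "(real^'p \<Rightarrow> real) set \<Rightarrow> real \<Rightarrow> (nat \<times> (nat \<Rightarrow> real^'p)) set" where
  "bounded_samples \<Psi> K = {z. \<forall>f\<in>\<Psi>. \<bar>sample_avg f z - \<mu> f\<bar> \<le> K / sqrt (real (fst z))}"

text \<open>Landau statements along this filter concern pairs of a sample size and a sample, and hold
  uniformly over the samples in \<^term>\<open>bounded_samples \<Psi> K\<close>.\<close>

definition sample_filter :: "(real^'p \<Rightarrow> real) set \<Rightarrow> real \<Rightarrow> (nat \<times> (nat \<Rightarrow> real^'p)) filter" where
  "sample_filter \<Psi> K = inf (filtercomap fst at_top) (principal (bounded_samples \<Psi> K))"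

lemma eventually_sample_filter:
  "eventually P (sample_filter \<Psi> K) \<longleftrightarrow> (\<exists>N. \<forall>n\<ge>N. \<forall>x. (n, x) \<in> bounded_samples \<Psi> K \<longrightarrow> P (n, x))"
  unfolding sample_filter_def eventually_inf_principal eventually_filtercomap_at_top_linorder
  by (auto simp: split_paired_all)

lemma sample_filter_size: "filterlim fst at_top (sample_filter \<Psi> K)"
  unfolding filterlim_at_top eventually_sample_filter by auto

lemma sample_filter_bigo:
  assumes "f \<in> \<Psi>"
  shows "(\<lambda>z. sample_avg f z - \<mu> f) \<in> O[sample_filter \<Psi> K](root_rate)"
  by (rule bigoI[of _ K]) (use assms in \<open>auto simp: eventually_sample_filter bounded_samples_def\<close>)

text \<open>By Chebyshev, the limsup of the probability that \<open>R\<close> is large is at most a multiple of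
  \<open>1 / K\<^sup>2\<close>, for every \<open>K\<close>.\<close>

lemma small_op_1_of_sample_filter:
  assumes fin: "finite \<Psi>" and growth: "\<And>f. f \<in> \<Psi> \<Longrightarrow> exp_growth f"
    and meas: "\<And>n. (\<lambda>\<omega>. R (n, \<lambda>i. X i \<omega>)) \<in> borel_measurable M"
    and lim: "\<And>K. K > 0 \<Longrightarrow> (R \<longlongrightarrow> 0) (sample_filter \<Psi> K)"
  shows "small_op_1 M (\<lambda>n \<omega>. R (n, \<lambda>i. X i \<omega>))"
  unfolding small_op_1_def
proof (intro conjI allI impI meas)
  fix \<epsilon> :: real assume eps: "\<epsilon> > 0"
  have "\<exists>V. 0 \<le> V \<and> (\<forall>n K. n > 0 \<longrightarrow> K > 0 \<longrightarrow>
    prob {\<omega> \<in> space M. deviation f n \<omega> \<ge> K / sqrt (real n)} \<le> V / K\<^sup>2)" if "f \<in> \<Psi>" for f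
    using deviation_prob_le[OF growth[OF that]] by metis
  then have "\<forall>f\<in>\<Psi>. \<exists>V. 0 \<le> V \<and> (\<forall>n K. n > 0 \<longrightarrow> K > 0 \<longrightarrow>
    prob {\<omega> \<in> space M. deviation f n \<omega> \<ge> K / sqrt (real n)} \<le> V / K\<^sup>2)" by blast
  from bchoice[OF this] obtain V where V: "\<And>f. f \<in> \<Psi> \<Longrightarrow> 0 \<le> V f" "\<And>f n K. f \<in> \<Psi> \<Longrightarrow> n > 0 \<Longrightarrow> K > 0 \<Longrightarrow>
    prob {\<omega> \<in> space M. deviation f n \<omega> \<ge> K / sqrt (real n)} \<le> V f / K\<^sup>2"
    by blast
  define C where "C = (\<Sum>f\<in>\<Psi>. V f)"
  have C: "0 \<le> C" unfolding C_def by (intro sum_nonneg V)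
  show "(\<lambda>n. prob {\<omega> \<in> space M. \<epsilon> < \<bar>R (n, \<lambda>i. X i \<omega>)\<bar>}) \<longlonglongrightarrow> 0"
  proof (rule LIMSEQ_I)
    fix r :: real assume r: "0 < r"
    \<comment> \<open>With this choice C / K^2 = r C / (C + 1), which is below r.\<close>
    define K where "K = sqrt ((C + 1) / r)"
    have K: "K > 0" "C / K\<^sup>2 < r"
      using C r by (simp_all add: K_def field_simps)
    have "\<forall>\<^sub>F z in sample_filter \<Psi> K. \<bar>R z\<bar> < \<epsilon>"
      using tendstoD[OF lim[OF K(1)] eps] by (simp add: dist_norm)
    then obtain N where N: "\<And>n x. n \<ge> N \<Longrightarrow> (n, x) \<in> bounded_samples \<Psi> K \<Longrightarrow> \<bar>R (n, x)\<bar> < \<epsilon>"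
      unfolding eventually_sample_filter by auto
    show "\<exists>n0. \<forall>n\<ge>n0. norm (prob {\<omega> \<in> space M. \<epsilon> < \<bar>R (n, \<lambda>i. X i \<omega>)\<bar>} - 0) < r"
    proof (intro exI[of _ "max N 1"] allI impI)
      fix n assume n: "max N 1 \<le> n"
      let ?A = "\<lambda>f. {\<omega> \<in> space M. deviation f n \<omega> \<ge> K / sqrt (real n)}"
      have A: "?A f \<in> events" if "f \<in> \<Psi>" for f
        using deviation_measurable[OF exp_growth_measurable[OF growth[OF that]], of n] by measurable
      have "{\<omega> \<in> space M. \<epsilon> < \<bar>R (n, \<lambda>i. X i \<omega>)\<bar>} \<subseteq> (\<Union>f\<in>\<Psi>. ?A f)"
      proof
        fix \<omega> assume w: "\<omega> \<in> {\<omega> \<in> space M. \<epsilon> < \<bar>R (n, \<lambda>i. X i \<omega>)\<bar>}"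
        then have "(n, \<lambda>i. X i \<omega>) \<notin> bounded_samples \<Psi> K" using N[of n] n by force
        then obtain f where f: "f \<in> \<Psi>" "K / sqrt (real n) < deviation f n \<omega>"
          by (auto simp: bounded_samples_def deviation_def not_le)
        have "\<omega> \<in> ?A f" using w less_imp_le[OF f(2)] by simp
        then show "\<omega> \<in> (\<Union>f\<in>\<Psi>. ?A f)" using f(1) by (rule UN_I[rotated])
      qed
      then have "prob {\<omega> \<in> space M. \<epsilon> < \<bar>R (n, \<lambda>i. X i \<omega>)\<bar>} \<le> prob (\<Union>f\<in>\<Psi>. ?A f)"
        using A fin by (intro finite_measure_mono) auto
      also have "\<dots> \<le> (\<Sum>f\<in>\<Psi>. prob (?A f))"
        by (rule finite_measure_subadditive_finite) (use A fin in auto)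
      also have "\<dots> \<le> (\<Sum>f\<in>\<Psi>. V f / K\<^sup>2)"
        using n K by (intro sum_mono V) auto
      also have "\<dots> = C / K\<^sup>2" by (simp add: C_def sum_divide_distrib)
      finally show "norm (prob {\<omega> \<in> space M. \<epsilon> < \<bar>R (n, \<lambda>i. X i \<omega>)\<bar>} - 0) < r"
        using K by simp
    qed
  qed
qed

text \<open>One function for each average that \<open>regular_samples\<close> constrains. Unions of
  singletons over finite index types make finiteness immediate.\<close>

definition control_functions :: "real^'p \<Rightarrow> (real^'p \<Rightarrow> real) set" where
  "control_functions t = (\<Union>k. {\<lambda>x. x $ k}) \<union> (\<Union>k l. {\<lambda>x. x $ k * x $ l})
    \<union> {\<lambda>x. exp (t \<bullet> x)} \<union> (\<Union>k. {\<lambda>x. exp (t \<bullet> x) * x $ k}) \<union> (\<Union>k l. {\<lambda>x. exp (t \<bullet> x) * x $ k * x $ l})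
    \<union> (\<Union>i j k. {\<lambda>x. exp (t \<bullet> x) * x $ i * x $ j * x $ k})
    \<union> {\<lambda>x. exp (envelope_exponent t * norm x)}"

lemma finite_control_functions: "finite (control_functions t)"
  unfolding control_functions_def by simp

lemma exp_growth_control_functions: "f \<in> control_functions t \<Longrightarrow> exp_growth f"
  unfolding control_functions_def
  by (auto intro!: exp_growth_mult exp_growth_nth exp_growth_exp_inner exp_growth_exp_norm)

lemma control_functions_mem:
  "(\<lambda>x. x $ k) \<in> control_functions t"
  "(\<lambda>x. x $ k * x $ l) \<in> control_functions t"
  "(\<lambda>x. exp (t \<bullet> x)) \<in> control_functions t"
  "(\<lambda>x. exp (t \<bullet> x) * x $ k) \<in> control_functions t"
  "(\<lambda>x. exp (t \<bullet> x) * x $ k * x $ l) \<in> control_functions t"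
  "(\<lambda>x. exp (t \<bullet> x) * x $ i * x $ j * x $ k) \<in> control_functions t"
  "(\<lambda>x. exp (envelope_exponent t * norm x)) \<in> control_functions t"
proof -
  have "(\<lambda>x. x $ k) \<in> (\<Union>k. {\<lambda>x :: real^'p. x $ k})"
    "(\<lambda>x. x $ k * x $ l) \<in> (\<Union>k l. {\<lambda>x :: real^'p. x $ k * x $ l})"
    "(\<lambda>x. exp (t \<bullet> x) * x $ k) \<in> (\<Union>k. {\<lambda>x :: real^'p. exp (t \<bullet> x) * x $ k})"
    "(\<lambda>x. exp (t \<bullet> x) * x $ k * x $ l) \<in> (\<Union>k l. {\<lambda>x :: real^'p. exp (t \<bullet> x) * x $ k * x $ l})"
    "(\<lambda>x. exp (t \<bullet> x) * x $ i * x $ j * x $ k) \<in> (\<Union>i j k. {\<lambda>x :: real^'p. exp (t \<bullet> x) * x $ i * x $ j * x $ k})"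
    by (rule UN_I UNIV_I singletonI)+
  then show
    "(\<lambda>x. x $ k) \<in> control_functions t"
    "(\<lambda>x. x $ k * x $ l) \<in> control_functions t"
    "(\<lambda>x. exp (t \<bullet> x)) \<in> control_functions t"
    "(\<lambda>x. exp (t \<bullet> x) * x $ k) \<in> control_functions t"
    "(\<lambda>x. exp (t \<bullet> x) * x $ k * x $ l) \<in> control_functions t"
    "(\<lambda>x. exp (t \<bullet> x) * x $ i * x $ j * x $ k) \<in> control_functions t"
    "(\<lambda>x. exp (envelope_exponent t * norm x)) \<in> control_functions t"
    by (simp_all only: control_functions_def Un_iff singleton_iff simp_thms)
qed

lemma control_functions_mean:
  "\<mu> (\<lambda>x. x $ k) = 0"
  "\<mu> (\<lambda>x. x $ k * x $ l) = (if k = l then 1 else 0)"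
  "\<mu> (\<lambda>x. exp (t \<bullet> x)) = exp ((norm t)\<^sup>2 / 2)"
  "\<mu> (\<lambda>x. exp (t \<bullet> x) * x $ k) = t $ k * exp ((norm t)\<^sup>2 / 2)"
  "\<mu> (\<lambda>x. exp (t \<bullet> x) * x $ k * x $ l) = ((if k = l then 1 else 0) + t $ k * t $ l) * exp ((norm t)\<^sup>2 / 2)"
  "\<mu> (\<lambda>x. exp (t \<bullet> x) * x $ i * x $ j * x $ k) = ((if i = k then t $ j else 0) + (if j = k then t $ i else 0)
           + ((if i = j then 1 else 0) + t $ i * t $ j) * t $ k) * exp ((norm t)\<^sup>2 / 2)"
proof -
  interpret Y: std_mvn M "X 0" by (rule std_mvn_X)
  \<comment> \<open>At tilt 0 the exponential weight is 1, so the tilted moments are the plain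
    ones.\<close>
  show "\<mu> (\<lambda>x. x $ k) = 0" "\<mu> (\<lambda>x. x $ k * x $ l) = (if k = l then 1 else 0)"
    using Y.tilted_moment_1[of k 0] Y.tilted_moment_2[of k l 0] by (simp_all add: \<mu>_def)
  show "\<mu> (\<lambda>x. exp (t \<bullet> x)) = exp ((norm t)\<^sup>2 / 2)"
    "\<mu> (\<lambda>x. exp (t \<bullet> x) * x $ k) = t $ k * exp ((norm t)\<^sup>2 / 2)"
    "\<mu> (\<lambda>x. exp (t \<bullet> x) * x $ k * x $ l) = ((if k = l then 1 else 0) + t $ k * t $ l) * exp ((norm t)\<^sup>2 / 2)"
    "\<mu> (\<lambda>x. exp (t \<bullet> x) * x $ i * x $ j * x $ k) = ((if i = k then t $ j else 0) + (if j = k then t $ i else 0)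
           + ((if i = j then 1 else 0) + t $ i * t $ j) * t $ k) * exp ((norm t)\<^sup>2 / 2)"
    using Y.tilted_moment_0[of t] Y.tilted_moment_1[of k t] Y.tilted_moment_2[of k l t] Y.tilted_moment_3[of i j k t]
    by (simp_all only: \<mu>_def mult.commute mult.left_commute)
qed

lemma regular_samples_filter: "regular_samples (sample_filter (control_functions t) K) t"
proof
  let ?F = "sample_filter (control_functions t) K"
  have B: "(\<lambda>z. sample_avg f z - \<mu> f) \<in> O[?F](root_rate)" if "f \<in> control_functions t" for f
    using that by (rule sample_filter_bigo)
  show size: "filterlim fst at_top ?F" by (rule sample_filter_size)
  show "sample_avg (\<lambda>x. x $ k) \<in> O[?F](root_rate)" for k
    using B[of "\<lambda>x. x $ k"] by (simp add: control_functions_mean(1) control_functions_mem)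
  show "(\<lambda>z. sample_avg (\<lambda>x. x $ k * x $ l) z - (if k = l then 1 else 0)) \<in> O[?F](root_rate)" for k l
    unfolding control_functions_mean(2)[symmetric] by (intro B control_functions_mem)
  show "(\<lambda>z. sample_avg (\<lambda>x. exp (t \<bullet> x)) z - exp ((norm t)\<^sup>2 / 2)) \<in> O[?F](root_rate)"
    unfolding control_functions_mean(3)[symmetric] by (intro B control_functions_mem)
  show "(\<lambda>z. sample_avg (\<lambda>x. exp (t \<bullet> x) * x $ k) z - t $ k * exp ((norm t)\<^sup>2 / 2)) \<in> O[?F](root_rate)" for k
    unfolding control_functions_mean(4)[symmetric] by (intro B control_functions_mem)
  show "(\<lambda>z. sample_avg (\<lambda>x. exp (t \<bullet> x) * x $ k * x $ l) z
        - ((if k = l then 1 else 0) + t $ k * t $ l) * exp ((norm t)\<^sup>2 / 2)) \<in> O[?F](root_rate)" for k l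
    unfolding control_functions_mean(5)[symmetric] by (intro B control_functions_mem)
  show "(\<lambda>z. sample_avg (\<lambda>x. exp (t \<bullet> x) * x $ i * x $ j * x $ k) z
        - ((if i = k then t $ j else 0) + (if j = k then t $ i else 0)
           + ((if i = j then 1 else 0) + t $ i * t $ j) * t $ k) * exp ((norm t)\<^sup>2 / 2)) \<in> O[?F](root_rate)" for i j k
    unfolding control_functions_mean(6)[symmetric] by (intro B control_functions_mem)
  have root: "root_rate \<in> O[?F](\<lambda>_. 1)"
  proof (rule bigoI[of _ 1])
    show "\<forall>\<^sub>F z in ?F. norm (root_rate z) \<le> 1 * norm (1 :: real)"
      unfolding eventually_sample_filter by (rule exI[of _ 1]) simp
  qed
  let ?g = "\<lambda>x. exp (envelope_exponent t * norm x)"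
  have "(\<lambda>z. sample_avg ?g z - \<mu> ?g) \<in> O[?F](\<lambda>_. 1)"
    by (rule landau_o.big_trans[OF B root]) (rule control_functions_mem)
  then show "sample_avg ?g \<in> O[?F](\<lambda>_. 1)"
    using sum_in_bigo(1)[of "\<lambda>z. sample_avg ?g z - \<mu> ?g" ?F "\<lambda>_. 1" "\<lambda>_. \<mu> ?g"] by simp
qed

end

text \<open>Singular samples are covered because \<^const>\<open>inv_sqrt\<close> is measurable everywhere.\<close>

lemma remainder_measurable:
  fixes X :: "nat \<Rightarrow> 'a \<Rightarrow> real^'p"
  assumes [measurable]: "\<And>i. X i \<in> borel_measurable M"
  shows "(\<lambda>\<omega>. (sqrt (real n) *\<^sub>R (hess_emp_cgf n (\<lambda>i. X i \<omega>) t - mat 1)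
            - (1 / sqrt (real n)) *\<^sub>R (\<Sum>i<n. h (X i \<omega>) t)) $ a $ b) \<in> borel_measurable M"
proof -
  have mean [measurable]: "(\<lambda>\<omega>. sample_mean n (\<lambda>i. X i \<omega>)) \<in> borel_measurable M"
    unfolding sample_mean_def by measurable
  have cov [measurable]: "(\<lambda>\<omega>. sample_cov n (\<lambda>i. X i \<omega>)) \<in> borel_measurable M"
    unfolding sample_cov_def outer_def by (rule borel_measurable_matrixI) (simp add: sum_component)
  have root [measurable]: "(\<lambda>\<omega>. inv_sqrt (sample_cov n (\<lambda>i. X i \<omega>))) \<in> borel_measurable M"
    by (rule measurable_compose[OF cov borel_measurable_inv_sqrt])
  have res [measurable]: "(\<lambda>\<omega>. scaled_residual n (\<lambda>i. X i \<omega>) i) \<in> borel_measurable M" for i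
    unfolding scaled_residual_def matrix_vector_mult_def by (rule borel_measurable_vecI) simp
  have mgf [measurable]: "(\<lambda>\<omega>. emp_mgf n (\<lambda>i. X i \<omega>) t) \<in> borel_measurable M"
    unfolding emp_mgf_def by measurable
  have grad [measurable]: "(\<lambda>\<omega>. grad_emp_mgf n (\<lambda>i. X i \<omega>) t) \<in> borel_measurable M"
    unfolding grad_emp_mgf_def by measurable
  have hess [measurable]: "(\<lambda>\<omega>. hess_emp_mgf n (\<lambda>i. X i \<omega>) t) \<in> borel_measurable M"
    unfolding hess_emp_mgf_def outer_def by (rule borel_measurable_matrixI) (simp add: sum_component)
  \<comment> \<open>The influence form replaces the matrix derivatives in \<open>f2\<close> by
    finite sums of products of coordinates.\<close>
  have h [measurable]: "(\<lambda>\<omega>. h (X i \<omega>) t $ a $ b) \<in> borel_measurable M" for i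
    unfolding h_def g1_def g2_def f0_eq_influence
    by (simp add: outer_def mat_def f1_eq_influence f2_eq_influence f0_eq_influence influence_def)
  show ?thesis
    unfolding hess_emp_cgf_def by (simp add: outer_def mat_def sum_component)
qed

theorem theorem1:
  fixes M :: "'a measure" and X :: "nat \<Rightarrow> 'a \<Rightarrow> real^'p" and t :: "real^'p"
  assumes "prob_space M"
    and "prob_space.indep_vars M (\<lambda>_. borel) X UNIV"
    and "\<And>i. distributed M lborel (X i) std_mvn_density"
  shows "\<forall>a b. small_op_1 M (\<lambda>n \<omega>.
           (sqrt (real n) *\<^sub>R (hess_emp_cgf n (\<lambda>i. X i \<omega>) t - mat 1)
            - (1 / sqrt (real n)) *\<^sub>R (\<Sum>i<n. h (X i \<omega>) t)) $ a $ b)"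
proof (intro allI)
  fix a b
  interpret iid_std_mvn M X
    using assms by (simp add: iid_std_mvn_def iid_std_mvn_axioms_def)
  let ?R = "\<lambda>z. (sqrt (real (fst z)) *\<^sub>R (hess_emp_cgf (fst z) (snd z) t - mat 1)
      - (1 / sqrt (real (fst z))) *\<^sub>R (\<Sum>i<fst z. h (snd z i) t)) $ a $ b"
  have "small_op_1 M (\<lambda>n \<omega>. ?R (n, \<lambda>i. X i \<omega>))"
    using finite_control_functions exp_growth_control_functions
  proof (rule small_op_1_of_sample_filter)
    show "(\<lambda>\<omega>. ?R (n, \<lambda>i. X i \<omega>)) \<in> borel_measurable M" for n
      unfolding fst_conv snd_conv by (rule remainder_measurable) measurable
    show "(?R \<longlongrightarrow> 0) (sample_filter (control_functions t) K)" for K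
      by (rule regular_samples.hess_emp_cgf_remainder_tendsto[OF regular_samples_filter])
  qed
  then show "small_op_1 M (\<lambda>n \<omega>.
           (sqrt (real n) *\<^sub>R (hess_emp_cgf n (\<lambda>i. X i \<omega>) t - mat 1)
            - (1 / sqrt (real n)) *\<^sub>R (\<Sum>i<n. h (X i \<omega>) t)) $ a $ b)"
    by simp
qed

end
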